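(* Let $$D=\{(x,y)\in{}^2({}^\omega 2):(\exists i<j)(\delta_i^j(x,y)>2\wedge(\forall n)(i\le n<j\Rightarrow x(n)\neq y(n)))\}.$$ Then $D$ is dense open in ${}^2({}^\omega 2)$. Suppose $(m_k:k\in\omega)$ is a strictly increasing sequence of natural numbers with $m_0=0$ and $g:{}^{<\omega}2\to{}^{<\omega}2$ satisfies: (1) if $|s|=k$ then $|g(s)|=m_k$; (2) if $s\subseteq t$ then $g(s)\subseteq g(t)$; (3) if $|s|=|t|=k>0$ and $s(k-1)=t(k-1)$ then $\delta_{m_{k-1}}^{m_k}(g(s),g(t))<2^{-(k+1)}$; (4) if $|s|=|t|=k>0$ and $s(k-1)\neq t(k-1)$ then $|\delta_{m_{k-1}}^{m_k}(g(s),g(t))-\frac1k|<2^{-(k+1)}$; and let $\Phi:{}^\omega2\to{}^\omega2$ be $\Phi(x)=\bigcup_n g(x\upharpoonright n)$, where $\Phi$ is a $\Delta^1_1$ function witnessing $E_2\le_{\Delta^1_1}E_2\upharpoonright\Phi[{}^\omega 2]$. Then $(\Phi(\tilde0),\Phi(\widetilde{01}))\notin D$. Furthermore, for any $\Delta^1_1$ set $B\subseteq{}^\omega 2$ with $E_2\upharpoonright B\equiv_{\Delta^1_1}E_2$, $[B]^2_{E_2}\not\subseteq D$. Consequently $E_2$ does not have the $2$-Mycielski property.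
   Context: For $x,y\in{}^N2$ ($N\le\omega$) and $m<n\le N$, $\delta_m^n(x,y)=\sum\{\frac1{k+1}: m\le k<n,\ x(k)\neq y(k)\}$; $\delta(x,y)=\delta_0^\omega(x,y)$. $E_2$ is the equivalence relation on ${}^\omega2$ given by $x\,E_2\,y$ iff $\delta(x,y)<\infty$. For $\sigma\in{}^{<\omega}2$ of length $k>0$, $\tilde\sigma(n)=\sigma(n\bmod k)$; so $\tilde0$ is the constant $0$ sequence and $\widetilde{01}=0101\dots$. For an equivalence relation $E$ on a set $X$, $[X]^n_E=\{(x_0,\dots,x_{n-1})\in{}^nX:(\forall i\neq j)\,\neg(x_i\,E\,x_j)\}$. $E\le_{\Delta^1_1}F$ means there is a $\Delta^1_1$ function $\Phi$ with $a\,E\,b\iff\Phi(a)\,F\,\Phi(b)$; $E\equiv_{\Delta^1_1}F$ means both directions. An equivalence relation $E$ on a Polish space $X$ has the $n$-Mycielski property iff for every comeager $C\subseteq{}^nX$ there is a $\Delta^1_1$ set $A\subseteq X$ with $E\equiv_{\Delta^1_1}E\upharpoonright A$ and $[A]^n_E\subseteq C$. *)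

theory Defs
  imports "HOL-Analysis.Analysis" "HOL-Library.Sublist"
begin

subsection \<open>Cantor space, finite sequences and the relation \<open>E\<^sub>2\<close>\<close>

text \<open>
  Cantor space is the type \<open>nat \<Rightarrow> bool\<close> with the product topology of the type class instance;
  \<open>False\<close> is 0 and \<open>True\<close> is 1. Finite binary sequences are lists of booleans.
\<close>

type_synonym cantor = "nat \<Rightarrow> bool"

definition restr :: "cantor \<Rightarrow> nat \<Rightarrow> bool list" where
  "restr x n = map x [0..<n]"

definition tilde :: "bool list \<Rightarrow> cantor" where
  "tilde \<sigma> = (\<lambda>n. \<sigma> ! (n mod length \<sigma>))"

text \<open>
  For finite sequences \<open>s\<close>, \<open>t\<close> of length at least \<open>n\<close>, the quantity
  \<open>\<delta>\<^sub>m\<^sup>n(s,t)\<close> is \<open>delta m n ((!) s) ((!) t)\<close>; only the positions below \<open>n\<close> are inspected.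
\<close>

definition delta :: "nat \<Rightarrow> nat \<Rightarrow> cantor \<Rightarrow> cantor \<Rightarrow> real" where
  "delta m n x y = (\<Sum>k \<in> {k. m \<le> k \<and> k < n \<and> x k \<noteq> y k}. 1 / (real k + 1))"

definition delta_inf :: "cantor \<Rightarrow> cantor \<Rightarrow> ennreal" where
  "delta_inf x y = (\<Sum>k. if x k \<noteq> y k then ennreal (1 / (real k + 1)) else 0)"

definition E2 :: "cantor \<Rightarrow> cantor \<Rightarrow> bool" where
  "E2 x y \<longleftrightarrow> delta_inf x y < \<infinity>"


subsection \<open>Boldface projective classes and reductions\<close>

text \<open>
  \<open>\<Sigma>\<^sup>1\<^sub>1\<close> sets are the projections of closed subsets of the product with Baire space
  \<open>nat \<Rightarrow> nat\<close>. The definitions are intended for Polish spaces; the weaker sort is used because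
  the function space \<open>nat \<Rightarrow> bool\<close> is not an instance of the (metric) class of Polish spaces.
\<close>

definition Sigma11 :: "'a::topological_space set \<Rightarrow> bool" where
  "Sigma11 A \<longleftrightarrow> (\<exists>F :: ('a \<times> (nat \<Rightarrow> nat)) set. closed F \<and> A = fst ` F)"

definition Pi11 :: "'a::topological_space set \<Rightarrow> bool" where
  "Pi11 A \<longleftrightarrow> Sigma11 (- A)"

definition Delta11 :: "'a::topological_space set \<Rightarrow> bool" where
  "Delta11 A \<longleftrightarrow> Sigma11 A \<and> Pi11 A"

text \<open>A \<open>\<Delta>\<^sup>1\<^sub>1\<close> function from \<open>A\<close> to \<open>B\<close> is one whose graph is a \<open>\<Delta>\<^sup>1\<^sub>1\<close> set.\<close>

definition Delta11_fun ::
  "'a::topological_space set \<Rightarrow> 'b::topological_space set \<Rightarrow> ('a \<Rightarrow> 'b) \<Rightarrow> bool" where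
  "Delta11_fun A B \<Phi> \<longleftrightarrow> \<Phi> \<in> A \<rightarrow> B \<and> Delta11 {(a, \<Phi> a) | a. a \<in> A}"

text \<open>
  The restriction of \<open>E\<close> to \<open>A\<close> is given by the pair \<open>A\<close>, \<open>E\<close>; the unrestricted relation is
  the pair \<open>UNIV\<close>, \<open>E\<close>.
\<close>

definition witnesses_red ::
  "('a::topological_space \<Rightarrow> 'b::topological_space) \<Rightarrow>
   'a set \<Rightarrow> ('a \<Rightarrow> 'a \<Rightarrow> bool) \<Rightarrow> 'b set \<Rightarrow> ('b \<Rightarrow> 'b \<Rightarrow> bool) \<Rightarrow> bool" where
  "witnesses_red \<Phi> A E B F \<longleftrightarrow>
     Delta11_fun A B \<Phi> \<and> (\<forall>a\<in>A. \<forall>b\<in>A. E a b \<longleftrightarrow> F (\<Phi> a) (\<Phi> b))"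

definition reducible ::
  "'a::topological_space set \<Rightarrow> ('a \<Rightarrow> 'a \<Rightarrow> bool) \<Rightarrow>
   'b::topological_space set \<Rightarrow> ('b \<Rightarrow> 'b \<Rightarrow> bool) \<Rightarrow> bool" where
  "reducible A E B F \<longleftrightarrow> (\<exists>\<Phi>. witnesses_red \<Phi> A E B F)"

definition bireducible ::
  "'a::topological_space set \<Rightarrow> ('a \<Rightarrow> 'a \<Rightarrow> bool) \<Rightarrow>
   'b::topological_space set \<Rightarrow> ('b \<Rightarrow> 'b \<Rightarrow> bool) \<Rightarrow> bool" where
  "bireducible A E B F \<longleftrightarrow> reducible A E B F \<and> reducible B F A E"


subsection \<open>Finite powers, comeager sets and the Mycielski property\<close>

text \<open>
  The power \<open>\<^sup>nX\<close> consists of the functions on \<open>{..<n}\<close>, extended by \<open>undefined\<close>, as is usual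
  for the library's product topology; \<open>tuple\<close> turns a list into the corresponding element.
\<close>

definition power_top :: "nat \<Rightarrow> (nat \<Rightarrow> 'a::topological_space) topology" where
  "power_top n = product_topology (\<lambda>_. euclidean) {..<n}"

definition tuple :: "'a list \<Rightarrow> nat \<Rightarrow> 'a" where
  "tuple xs = (\<lambda>i\<in>{..<length xs}. xs ! i)"

definition bracket :: "nat \<Rightarrow> 'a set \<Rightarrow> ('a \<Rightarrow> 'a \<Rightarrow> bool) \<Rightarrow> (nat \<Rightarrow> 'a) set" where
  "bracket n A E =
     {p \<in> {..<n} \<rightarrow>\<^sub>E A. \<forall>i<n. \<forall>j<n. i \<noteq> j \<longrightarrow> \<not> E (p i) (p j)}"

definition nowhere_dense_in :: "'a topology \<Rightarrow> 'a set \<Rightarrow> bool" where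
  "nowhere_dense_in T S \<longleftrightarrow> S \<subseteq> topspace T \<and> T interior_of (T closure_of S) = {}"

definition meager_in :: "'a topology \<Rightarrow> 'a set \<Rightarrow> bool" where
  "meager_in T S \<longleftrightarrow>
     (\<exists>N :: nat \<Rightarrow> 'a set. (\<forall>k. nowhere_dense_in T (N k)) \<and> S = (\<Union>k. N k))"

definition comeager_in :: "'a topology \<Rightarrow> 'a set \<Rightarrow> bool" where
  "comeager_in T C \<longleftrightarrow> C \<subseteq> topspace T \<and> meager_in T (topspace T - C)"

definition Mycielski_property :: "nat \<Rightarrow> ('a::topological_space \<Rightarrow> 'a \<Rightarrow> bool) \<Rightarrow> bool" where
  "Mycielski_property n E \<longleftrightarrow>
     (\<forall>C. comeager_in (power_top n) C \<longrightarrow>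
        (\<exists>A. Delta11 A \<and> bireducible UNIV E A E \<and> bracket n A E \<subseteq> C))"


definition D_set :: "(nat \<Rightarrow> cantor) set" where
  "D_set = {tuple [x, y] | x y.
     \<exists>i j. i < j \<and> delta i j x y > 2 \<and> (\<forall>n. i \<le> n \<and> n < j \<longrightarrow> x n \<noteq> y n)}"

end

theory Submission
  imports Defs
begin

text \<open>
  Let \<open>\<theta>\<close> be a reduction of \<open>E\<^sub>2\<close> to itself with \<open>\<Sigma>\<^sup>1\<^sub>1\<close> graph. Analytic sets have the Baire property, so
  \<open>\<theta>\<close> is continuous off a meager set. Since \<open>\<theta>\<close> preserves \<open>E\<^sub>2\<close>, a category argument yields a cylinder
  and a \<open>d > 0\<close> such that, for generic points of this cylinder, a finite modification of weight less
  than \<open>d\<close> moves the image by at most \<open>1/2\<close>. Starting from a generic \<open>x\<close> in the cylinder, flip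
  successively finite sets of weight between \<open>d/2\<close> and \<open>d\<close>, each so far out that the image is already
  decided up to a point after which it differs from \<open>\<theta> x\<close> by at most \<open>1/2\<close>. The total weight is
  infinite, so the limit \<open>y\<close> is not equivalent to \<open>x\<close>, but \<open>\<theta> x\<close> and \<open>\<theta> y\<close> keep agreeing at some places
  which are at most a bounded weight of disagreements apart: \<open>(\<theta> x, \<theta> y) \<notin> D\<close>.
\<close>

subsection \<open>Cylinders and meager sets\<close>

text \<open>The value type is arbitrary because cylinders of Baire space are needed as well, for the
  second coordinates of the closed set that projects onto an analytic set.\<close>

definition cyl :: "(nat \<Rightarrow> 'a) \<Rightarrow> nat \<Rightarrow> (nat \<Rightarrow> 'a) set" where
  "cyl x n = {z. \<forall>i<n. z i = x i}"

lemma cylI: "(\<And>i. i < n \<Longrightarrow> z i = x i) \<Longrightarrow> z \<in> cyl x n"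
  by (simp add: cyl_def)

lemma cylD: "z \<in> cyl x n \<Longrightarrow> i < n \<Longrightarrow> z i = x i"
  by (simp add: cyl_def)

lemma cyl_refl [simp]: "x \<in> cyl x n"
  by (simp add: cyl_def)

lemma cyl_antimono: "m \<le> n \<Longrightarrow> cyl x n \<subseteq> cyl x m"
  by (auto simp: cyl_def)

lemma cyl_eq: "z \<in> cyl x n \<Longrightarrow> cyl z n = cyl x n"
  by (auto simp: cyl_def)

lemma open_cyl: "open (cyl (x :: nat \<Rightarrow> 'a::discrete_topology) n)"
proof -
  have "open {f. \<forall>i\<in>{..<n}. f i \<in> {x i}}"
    by (rule product_topology_basis') (auto simp: open_discrete)
  also have "{f. \<forall>i\<in>{..<n}. f i \<in> {x i}} = cyl x n"
    by (auto simp: cyl_def)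
  finally show ?thesis .
qed

lemma open_contains_cyl:
  fixes U :: "(nat \<Rightarrow> 'a::topological_space) set"
  assumes "open U" "x \<in> U"
  obtains n where "cyl x n \<subseteq> U"
proof -
  have "openin (product_topology (\<lambda>i. euclidean) UNIV) U"
    using assms by (simp add: open_fun_def)
  from product_topology_open_contains_basis[OF this \<open>x \<in> U\<close>]
  have "\<exists>X. x \<in> (\<Pi>\<^sub>E i\<in>UNIV. X i) \<and> finite {i. X i \<noteq> UNIV} \<and> (\<Pi>\<^sub>E i\<in>UNIV. X i) \<subseteq> U"
    unfolding topspace_euclidean by (elim ex_forward) simp
  then obtain X where X: "x \<in> (\<Pi>\<^sub>E i\<in>UNIV. X i)" "finite {i. X i \<noteq> UNIV}" "(\<Pi>\<^sub>E i\<in>UNIV. X i) \<subseteq> U"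
    by (elim exE conjE)
  obtain n where "{i. X i \<noteq> UNIV} \<subseteq> {..<n}"
    using finite_nat_bounded[OF X(2)] ..
  then have n: "X i \<noteq> UNIV \<Longrightarrow> i < n" for i by auto
  have "cyl x n \<subseteq> (\<Pi>\<^sub>E i\<in>UNIV. X i)"
  proof
    fix z assume z: "z \<in> cyl x n"
    have "z i \<in> X i" for i
      using n[of i] X(1) cylD[OF z, of i] by (cases "X i = UNIV") auto
    then show "z \<in> (\<Pi>\<^sub>E i\<in>UNIV. X i)" by auto
  qed
  with X(3) show ?thesis using that by blast
qed

text \<open>In contrast to \<open>meager_in\<close>, the closed nowhere dense sets only have to
  cover \<open>S\<close>, which makes closure under subsets immediate.\<close>

definition meager :: "'a::topological_space set \<Rightarrow> bool" where
  "meager S \<longleftrightarrow> (\<exists>N :: nat \<Rightarrow> 'a set. (\<forall>k. closed (N k) \<and> interior (N k) = {}) \<and> S \<subseteq> (\<Union>k. N k))"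

lemma meager_subset: "meager S \<Longrightarrow> T \<subseteq> S \<Longrightarrow> meager T"
  unfolding meager_def by (meson order_trans)

lemma meager_empty [simp]: "meager {}"
  unfolding meager_def by (rule exI[of _ "\<lambda>_. {}"]) simp

lemma meager_nowhere_dense: "closed S \<Longrightarrow> interior S = {} \<Longrightarrow> meager S"
  unfolding meager_def by (rule exI[of _ "\<lambda>_. S"]) simp

lemma meager_UN_nat:
  fixes S :: "nat \<Rightarrow> 'a::topological_space set"
  assumes "\<And>k. meager (S k)"
  shows "meager (\<Union>k. S k)"
proof -
  have "\<forall>k. \<exists>N :: nat \<Rightarrow> 'a set. (\<forall>j. closed (N j) \<and> interior (N j) = {}) \<and> S k \<subseteq> (\<Union>j. N j)"
    using assms unfolding meager_def by (rule allI)
  from choice[OF this] obtain N :: "nat \<Rightarrow> nat \<Rightarrow> 'a set"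
    where "\<forall>k. (\<forall>j. closed (N k j) \<and> interior (N k j) = {}) \<and> S k \<subseteq> (\<Union>j. N k j)" ..
  then have N: "closed (N k j)" "interior (N k j) = {}" "S k \<subseteq> (\<Union>j. N k j)" for k j
    by simp_all
  define M where "M = (\<lambda>p. N (fst (prod_decode p)) (snd (prod_decode p)))"
  have "(\<Union>k. S k) \<subseteq> (\<Union>p. M p)"
  proof
    fix x assume "x \<in> (\<Union>k. S k)"
    then obtain k j where "x \<in> N k j" using N(3) by blast
    then have "x \<in> M (prod_encode (k, j))" by (simp add: M_def)
    then show "x \<in> (\<Union>p. M p)" by blast
  qed
  then show ?thesis
    unfolding meager_def using N(1,2) by (intro exI[of _ M]) (simp add: M_def)
qed

lemma meager_UN:
  assumes "countable I" "\<And>i. i \<in> I \<Longrightarrow> meager (S i)"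
  shows "meager (\<Union>i\<in>I. S i)"
proof (cases "I = {}")
  case False
  have "meager (\<Union>k. S (from_nat_into I k))"
    by (intro meager_UN_nat assms(2) from_nat_into False)
  moreover have "(\<Union>k. S (from_nat_into I k)) = (\<Union>i\<in>range (from_nat_into I). S i)"
    by simp
  ultimately show ?thesis
    by (simp add: range_from_nat_into[OF False assms(1)] del: UN_simps)
qed simp

lemma meager_Un: "meager S \<Longrightarrow> meager T \<Longrightarrow> meager (S \<union> T)"
  using meager_UN[of "{True, False}" "\<lambda>b. if b then S else T"] by (simp add: Un_commute)

text \<open>The Baire category theorem applies because Cantor space, a product of finite discrete
  spaces, is compact Hausdorff and hence locally compact and regular.\<close>

lemma not_meager_open:
  fixes U :: "cantor set"
  assumes "open U" "U \<noteq> {}"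
  shows "\<not> meager U"
proof
  assume "meager U"
  then obtain N :: "nat \<Rightarrow> cantor set"
    where N: "\<forall>k. closed (N k) \<and> interior (N k) = {}" "U \<subseteq> (\<Union>k. N k)"
    unfolding meager_def by blast
  have "compact_space (product_topology (\<lambda>_::nat. euclidean :: bool topology) UNIV)"
    unfolding compact_space_product_topology
    by (simp add: compact_space_def finite_imp_compact)
  moreover have "Hausdorff_space (euclidean :: bool topology)"
    unfolding Hausdorff_space_def
  proof (intro allI impI)
    fix x y :: bool
    assume "x \<in> topspace euclidean \<and> y \<in> topspace euclidean \<and> x \<noteq> y"
    then show "\<exists>U V. openin euclidean U \<and> openin euclidean V \<and> x \<in> U \<and> y \<in> V \<and> disjnt U V"
      by (intro exI[of _ "{x}"] exI[of _ "{y}"]) (simp add: open_discrete disjnt_def)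
  qed
  then have "Hausdorff_space (product_topology (\<lambda>_::nat. euclidean :: bool topology) UNIV)"
    unfolding Hausdorff_space_product_topology by blast
  ultimately have "locally_compact_space (euclidean :: cantor topology)"
    "regular_space (euclidean :: cantor topology)"
    unfolding euclidean_product_topology
    by (simp_all add: compact_imp_locally_compact_space compact_Hausdorff_imp_regular_space)
  then have "euclidean interior_of (\<Union>(range N)) = {}"
    using N(1) by (intro Baire_category_alt) auto
  moreover have "U \<subseteq> interior (\<Union>(range N))"
    using N(2) assms(1) by (rule interior_maximal)
  ultimately show False using assms(2) by simp
qed

subsection \<open>The Baire property of analytic sets\<close>

text \<open>For a set \<open>A\<close>, this is the closed set which approximates \<open>A\<close> from above modulo meager sets.\<close>

definition envelope :: "cantor set \<Rightarrow> cantor set" where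
  "envelope A = {x. \<forall>n. \<not> meager (cyl x n \<inter> A)}"

lemma closed_envelope: "closed (envelope A)"
proof -
  have nbhd: "\<exists>T. open T \<and> x \<in> T \<and> T \<subseteq> - envelope A" if x: "x \<in> - envelope A" for x
  proof -
    obtain n where n: "meager (cyl x n \<inter> A)"
      using x by (auto simp: envelope_def)
    have "cyl x n \<subseteq> - envelope A"
    proof
      fix z assume "z \<in> cyl x n"
      then have "meager (cyl z n \<inter> A)" using n by (simp add: cyl_eq)
      then show "z \<in> - envelope A" by (auto simp: envelope_def)
    qed
    then show ?thesis
      by (intro exI[of _ "cyl x n"]) (simp add: open_cyl)
  qed
  show ?thesis
    unfolding closed_def by (subst open_subopen) (use nbhd in blast)
qed

text \<open>A point of \<open>A\<close> outside the envelope has a cylinder that meets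
  \<open>A\<close> in a meager set, and there are only countably many cylinders, one for each finite
  binary list.\<close>

lemma meager_diff_envelope: "meager (A - envelope A)"
proof -
  define I where "I = {s :: bool list. meager ({x. restr x (length s) = s} \<inter> A)}"
  have "meager (\<Union>s\<in>I. {x. restr x (length s) = s} \<inter> A)"
    by (rule meager_UN) (auto simp: I_def)
  moreover have "A - envelope A \<subseteq> (\<Union>s\<in>I. {x. restr x (length s) = s} \<inter> A)"
  proof
    fix x assume x: "x \<in> A - envelope A"
    then obtain n where n: "meager (cyl x n \<inter> A)" by (auto simp: envelope_def)
    have "{z. restr z n = restr x n} = cyl x n"
      by (auto simp: restr_def cyl_def)
    with n have "restr x n \<in> I" by (simp add: I_def) (simp add: restr_def)
    moreover have "x \<in> {z. restr z (length (restr x n)) = restr x n} \<inter> A"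
      using x by (simp add: restr_def)
    ultimately show "x \<in> (\<Union>s\<in>I. {x. restr x (length s) = s} \<inter> A)" by blast
  qed
  ultimately show ?thesis by (rule meager_subset)
qed

text \<open>Let \<open>W\<close> be the union of the interiors of the envelopes of the
  \<open>P k\<close>. If the closed set \<open>?E - W\<close> contained a cylinder, every envelope
  of a \<open>P k\<close> would be nowhere dense there. Then every \<open>P k\<close>, and so their
  union, would be meager in the cylinder, contradicting membership in \<open>?E\<close>.\<close>

lemma meager_envelope_UN:
  fixes P :: "nat \<Rightarrow> cantor set"
  shows "meager (envelope (\<Union>k. P k) - (\<Union>k. envelope (P k)))"
proof -
  let ?E = "envelope (\<Union>k. P k)"
  define W where "W = (\<Union>k. interior (envelope (P k)))"
  have "interior (?E - W) = {}"
  proof (rule ccontr)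
    assume "interior (?E - W) \<noteq> {}"
    then obtain x where x: "x \<in> interior (?E - W)" by blast
    obtain n where n: "cyl x n \<subseteq> interior (?E - W)"
      by (rule open_contains_cyl[OF open_interior x])
    then have sub: "cyl x n \<subseteq> ?E - W" using interior_subset by blast
    have nwd: "meager (cyl x n \<inter> envelope (P k))" for k
    proof (rule meager_nowhere_dense)
      have "- cyl x n = (\<Union>z\<in>- cyl x n. cyl z n)"
        by (auto simp: cyl_def)
      then have "open (- cyl x n)" using open_cyl by (metis open_UN)
      then show "closed (cyl x n \<inter> envelope (P k))"
        by (simp add: closed_Int closed_def[of "cyl x n"] closed_envelope)
      have "interior (envelope (P k)) \<subseteq> W" by (auto simp: W_def)
      then have "interior (envelope (P k)) \<inter> cyl x n = {}" using sub by blast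
      then show "interior (cyl x n \<inter> envelope (P k)) = {}"
        using interior_subset[of "cyl x n"] by auto
    qed
    have "meager ((\<Union>k. P k - envelope (P k)) \<union> (\<Union>k. cyl x n \<inter> envelope (P k)))"
      by (intro meager_Un meager_UN_nat meager_diff_envelope nwd)
    then have "meager (cyl x n \<inter> (\<Union>k. P k))"
      by (rule meager_subset) blast
    then have "x \<notin> ?E" by (auto simp: envelope_def)
    then show False using sub cyl_refl by blast
  qed
  moreover have "closed (?E - W)"
    unfolding W_def by (intro closed_Diff closed_envelope open_UN ballI open_interior)
  ultimately have "meager (?E - W)" by (intro meager_nowhere_dense)
  then show ?thesis
    by (rule meager_subset) (use interior_subset in \<open>auto simp: W_def\<close>)
qed

text \<open>The sets \<open>P s\<close> form the Suslin scheme of projections of those points of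
  \<open>F\<close> whose second coordinate extends \<open>s\<close>. A point of the envelope of
  \<open>P []\<close> outside the meager set \<open>M\<close> stays in the envelopes along some
  branch \<open>r\<close>. Nonmeager sets are nonempty, so \<open>(x, r)\<close> is a limit of
  points of \<open>F\<close> and lies in \<open>F\<close>. Hence \<open>A\<close> agrees with its
  envelope modulo a meager set.\<close>

lemma Sigma11_Baire_property:
  fixes A :: "cantor set"
  assumes "Sigma11 A"
  obtains M C where "meager M" "closed C" "\<And>x. x \<notin> M \<Longrightarrow> x \<in> A \<longleftrightarrow> x \<in> C"
proof -
  obtain F :: "(cantor \<times> (nat \<Rightarrow> nat)) set" where F: "closed F" "A = fst ` F"
    using assms unfolding Sigma11_def by blast
  define P where "P = (\<lambda>s. {x. \<exists>r. (x, r) \<in> F \<and> (\<forall>i<length s. r i = s ! i)})"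
  have P_split: "P s = (\<Union>k. P (s @ [k]))" for s
  proof (intro set_eqI iffI)
    fix x assume "x \<in> P s"
    then obtain r where r: "(x, r) \<in> F" "\<forall>i<length s. r i = s ! i" by (auto simp: P_def)
    then have "\<forall>i<length (s @ [r (length s)]). r i = (s @ [r (length s)]) ! i"
      by (auto simp: nth_append less_Suc_eq)
    with r(1) show "x \<in> (\<Union>k. P (s @ [k]))" unfolding P_def by blast
  next
    fix x assume "x \<in> (\<Union>k. P (s @ [k]))"
    then obtain k r where "(x, r) \<in> F" "\<forall>i<Suc (length s). r i = (s @ [k]) ! i"
      by (auto simp: P_def)
    then show "x \<in> P s"
      unfolding P_def by (auto simp: nth_append intro!: exI[of _ r])
  qed
  define M where "M = (\<Union>s. envelope (P s) - (\<Union>k. envelope (P (s @ [k]))))"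
  have M: "meager M"
    unfolding M_def
  proof (rule meager_UN)
    show "meager (envelope (P s) - (\<Union>k. envelope (P (s @ [k]))))" for s
      using meager_envelope_UN[of "\<lambda>k. P (s @ [k])"] P_split[of s] by simp
  qed simp
  have A: "A = P []" unfolding F(2) P_def by force
  have "x \<in> A" if "x \<notin> M" "x \<in> envelope (P [])" for x
  proof -
    have step: "\<exists>k. x \<in> envelope (P (s @ [k]))" if "x \<in> envelope (P s)" for s
      using that \<open>x \<notin> M\<close> unfolding M_def by blast
    have "\<exists>f. \<forall>n. (x \<in> envelope (P (f n)) \<and> length (f n) = n) \<and> (\<exists>k. f (Suc n) = f n @ [k])"
    proof (rule dependent_nat_choice)
      show "\<exists>s. x \<in> envelope (P s) \<and> length s = 0" using that by simp
      fix s n assume "x \<in> envelope (P s) \<and> length s = n"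
      then show "\<exists>t. (x \<in> envelope (P t) \<and> length t = Suc n) \<and> (\<exists>k. t = s @ [k])"
        using step by fastforce
    qed
    then obtain f where f: "\<And>n. x \<in> envelope (P (f n))" "\<And>n. length (f n) = n"
      "\<And>n. \<exists>k. f (Suc n) = f n @ [k]" by blast
    \<comment> \<open>\<open>f (Suc i)\<close> is the first list on the branch that is long enough
      to have an entry at \<open>i\<close>.\<close>
    define r where "r = (\<lambda>i. f (Suc i) ! i)"
    have f_r: "f n ! i = r i" if "i < n" for i n
      using that
    proof (induction n)
      case (Suc n)
      then show ?case
        using f(2)[of n] f(3)[of n] by (cases "i = n") (auto simp: r_def nth_append)
    qed simp
    have near: "\<exists>x'\<in>cyl x n. \<exists>r'\<in>cyl r n. (x', r') \<in> F" for n
    proof -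
      have "cyl x n \<inter> P (f n) \<noteq> {}"
        using f(1)[of n] meager_empty unfolding envelope_def by (metis (mono_tags, lifting) mem_Collect_eq)
      then obtain x' r' where *: "x' \<in> cyl x n" "(x', r') \<in> F" "\<forall>i<n. r' i = f n ! i"
        by (auto simp: P_def f(2))
      then have "r' \<in> cyl r n" by (simp add: cyl_def f_r)
      with * show ?thesis by blast
    qed
    have "(x, r) \<in> F"
    proof (rule ccontr)
      assume "(x, r) \<notin> F"
      then have "open (- F)" "(x, r) \<in> - F" using F(1) by (simp_all add: open_Compl)
      then obtain U V where UV: "open U" "open V" "(x, r) \<in> U \<times> V" "U \<times> V \<subseteq> - F"
        by (rule open_prod_elim)
      have "x \<in> U" "r \<in> V" using UV(3) by auto
      obtain n1 where n1: "cyl x n1 \<subseteq> U" by (rule open_contains_cyl[OF UV(1) \<open>x \<in> U\<close>])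
      obtain n2 where n2: "cyl r n2 \<subseteq> V" by (rule open_contains_cyl[OF UV(2) \<open>r \<in> V\<close>])
      have "cyl x (max n1 n2) \<times> cyl r (max n1 n2) \<subseteq> U \<times> V"
        using n1 n2 cyl_antimono[of n1 "max n1 n2" x] cyl_antimono[of n2 "max n1 n2" r]
        by (intro Sigma_mono) auto
      then have "cyl x (max n1 n2) \<times> cyl r (max n1 n2) \<subseteq> - F"
        using UV(4) by (rule order_trans)
      then show False using near[of "max n1 n2"] by blast
    qed
    then show "x \<in> A" unfolding F(2) by force
  qed
  moreover have "x \<in> envelope (P [])" if "x \<notin> A - envelope A" "x \<in> A" for x
    using that A by auto
  ultimately show ?thesis
    using that[of "M \<union> (A - envelope A)" "envelope (P [])"]
      meager_Un[OF M meager_diff_envelope[of A]] closed_envelope by blast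
qed

section \<open>Continuity off a meager set of functions with analytic graph\<close>

text \<open>A projection along both the image point and the witness for the graph is turned into a
  projection along a single element of Baire space: the parity of \<open>r k\<close> codes bit
  \<open>k\<close> of the image, and \<open>r k div 2\<close> codes the witness. The continuous map
  \<open>h\<close> decodes.\<close>

lemma Sigma11_coordinate_preimage:
  fixes \<theta> :: "cantor \<Rightarrow> cantor"
  assumes "Sigma11 {(a, \<theta> a) | a. a \<in> UNIV}"
  shows "Sigma11 {x. \<theta> x i = b}"
proof -
  obtain F :: "((cantor \<times> cantor) \<times> (nat \<Rightarrow> nat)) set"
    where F: "closed F" "{(a, \<theta> a) | a. a \<in> UNIV} = fst ` F"
    using assms unfolding Sigma11_def by blast
  define h :: "cantor \<times> (nat \<Rightarrow> nat) \<Rightarrow> (cantor \<times> cantor) \<times> (nat \<Rightarrow> nat)"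
    where "h = (\<lambda>p. ((fst p, \<lambda>k. odd (snd p k)), \<lambda>k. snd p k div 2))"
  have coord: "continuous_on UNIV (\<lambda>p :: cantor \<times> (nat \<Rightarrow> nat). snd p k)" for k
    using continuous_on_compose2[OF continuous_on_product_coordinates[of k] continuous_on_snd[OF continuous_on_id]]
    by simp
  have coord': "continuous_on UNIV (\<lambda>p :: cantor \<times> (nat \<Rightarrow> nat). q (snd p k))"
    for k and q :: "nat \<Rightarrow> 'c::topological_space"
    by (rule continuous_on_compose2[OF _ coord, of UNIV q]) (auto simp: continuous_on_discrete)
  have "continuous_on UNIV h"
    unfolding h_def
    by (intro continuous_on_Pair continuous_on_fst continuous_on_id
        continuous_on_coordinatewise_then_product coord')
  then have "closed (h -` F)" using F(1) by (simp add: closed_vimage)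
  moreover have "closed ((\<lambda>p :: cantor \<times> (nat \<Rightarrow> nat). odd (snd p i)) -` {b})"
    using coord'[of odd i] by (intro closed_vimage) (auto intro: finite_imp_closed)
  ultimately have "closed (h -` F \<inter> (\<lambda>p. odd (snd p i)) -` {b})" by (rule closed_Int)
  moreover have "{x. \<theta> x i = b} = fst ` (h -` F \<inter> (\<lambda>p. odd (snd p i)) -` {b})"
  proof (intro set_eqI iffI)
    fix x assume x: "x \<in> {x. \<theta> x i = b}"
    have "(x, \<theta> x) \<in> fst ` F" unfolding F(2)[symmetric] by blast
    then obtain s where s: "((x, \<theta> x), s) \<in> F" by auto
    define r where "r = (\<lambda>k. 2 * s k + of_bool (\<theta> x k))"
    have "h (x, r) = ((x, \<theta> x), s)" by (auto simp: h_def r_def fun_eq_iff)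
    moreover have "odd (r i) = b" using x by (auto simp: r_def)
    ultimately have "(x, r) \<in> h -` F \<inter> (\<lambda>p. odd (snd p i)) -` {b}" using s by simp
    from imageI[OF this, of fst] show "x \<in> fst ` (h -` F \<inter> (\<lambda>p. odd (snd p i)) -` {b})"
      by simp
  next
    fix x assume "x \<in> fst ` (h -` F \<inter> (\<lambda>p. odd (snd p i)) -` {b})"
    then obtain r where r: "h (x, r) \<in> F" "odd (r i) = b" by force
    then have "fst (h (x, r)) \<in> {(a, \<theta> a) | a. a \<in> UNIV}" unfolding F(2) by blast
    then have "\<theta> x = (\<lambda>k. odd (r k))" by (simp add: h_def)
    then have "\<theta> x i = b" using r(2) by simp
    then show "x \<in> {x. \<theta> x i = b}" by simp
  qed
  ultimately show ?thesis unfolding Sigma11_def by blast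
qed

text \<open>Off a meager set, the points at which coordinate \<open>i\<close> takes the wrong value
  \<open>\<not> \<theta> x i\<close> form a closed set. Since \<open>x\<close> is not in it, some
  cylinder around \<open>x\<close> avoids it, and on this cylinder coordinate \<open>i\<close> is
  constant off the meager set. Only \<open>n\<close> coordinates have to be treated at once.\<close>

lemma Sigma11_graph_continuous_off_meager:
  fixes \<theta> :: "cantor \<Rightarrow> cantor"
  assumes "Sigma11 {(a, \<theta> a) | a. a \<in> UNIV}"
  obtains M where "meager M"
    "\<And>x n. x \<notin> M \<Longrightarrow> \<exists>l. \<forall>z\<in>cyl x l - M. \<theta> z \<in> cyl (\<theta> x) n"
proof -
  have "\<exists>M C. meager M \<and> closed C \<and> (\<forall>x. x \<notin> M \<longrightarrow> (\<theta> x i = b \<longleftrightarrow> x \<in> C))" for i b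
  proof (rule Sigma11_Baire_property[OF Sigma11_coordinate_preimage[OF assms, of i b]])
    fix M C assume "meager M" "closed C" "\<And>x. x \<notin> M \<Longrightarrow> (x \<in> {x. \<theta> x i = b}) = (x \<in> C)"
    then show ?thesis by (intro exI[of _ M] exI[of _ C]) simp
  qed
  then obtain M C :: "nat \<Rightarrow> bool \<Rightarrow> cantor set"
    where MC_all: "\<forall>i b. meager (M i b) \<and> closed (C i b) \<and> (\<forall>x. x \<notin> M i b \<longrightarrow> (\<theta> x i = b \<longleftrightarrow> x \<in> C i b))"
    by metis
  then have M: "meager (M i b)" and C: "closed (C i b)"
    and MC: "x \<notin> M i b \<Longrightarrow> \<theta> x i = b \<longleftrightarrow> x \<in> C i b" for i b x
    by blast+
  define MM where "MM = (\<Union>i. M i True \<union> M i False)"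
  have "meager MM" unfolding MM_def by (intro meager_UN_nat meager_Un M)
  moreover have "\<exists>l. \<forall>z\<in>cyl x l - MM. \<theta> z \<in> cyl (\<theta> x) n" if x: "x \<notin> MM" for x n
  proof -
    have iff: "\<theta> z i = b \<longleftrightarrow> z \<in> C i b" if "z \<notin> MM" for z i b
      using that MC[of z i b] by (cases b) (auto simp: MM_def)
    have ex_l: "\<exists>l. cyl x l \<subseteq> - C i (\<not> \<theta> x i)" for i
    proof -
      have "x \<in> - C i (\<not> \<theta> x i)" using iff[OF x, of i "\<not> \<theta> x i"] by simp
      then show ?thesis using open_contains_cyl[of "- C i (\<not> \<theta> x i)" x] C by (metis open_Compl)
    qed
    define l where "l = (\<lambda>i. SOME l. cyl x l \<subseteq> - C i (\<not> \<theta> x i))"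
    have l: "cyl x (l i) \<subseteq> - C i (\<not> \<theta> x i)" for i
      unfolding l_def using ex_l[of i] by (rule someI_ex)
    \<comment> \<open>Inserting 0 keeps the maximum meaningful when \<open>n\<close> is 0.\<close>
    have "\<theta> z i = \<theta> x i" if "z \<in> cyl x (Max (insert 0 (l ` {..<n}))) - MM" "i < n" for z i
    proof -
      have "l i \<le> Max (insert 0 (l ` {..<n}))" using that(2) by (intro Max_ge) auto
      then have "z \<in> cyl x (l i)" using that(1) cyl_antimono by blast
      then have "z \<notin> C i (\<not> \<theta> x i)" using l by blast
      then show ?thesis using iff[of z i "\<not> \<theta> x i"] that(1) by auto
    qed
    then show ?thesis by (intro exI[of _ "Max (insert 0 (l ` {..<n}))"]) (auto intro: cylI)
  qed
  ultimately show ?thesis using that by blast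
qed

subsection \<open>Weights and \<open>E\<^sub>2\<close>\<close>

lemma delta_sum: "delta m n x y = (\<Sum>k\<in>{m..<n}. if x k \<noteq> y k then 1 / (real k + 1) else 0)"
proof -
  have "{k. m \<le> k \<and> k < n \<and> x k \<noteq> y k} = {k \<in> {m..<n}. x k \<noteq> y k}" by auto
  then show ?thesis unfolding delta_def by (simp only: sum.inter_filter[OF finite_atLeastLessThan])
qed

lemma delta_commute: "delta m n x y = delta m n y x"
  unfolding delta_sum by (rule sum.cong) auto

lemma delta_self [simp]: "delta m n x x = 0"
  unfolding delta_sum by simp

lemma delta_nonneg: "0 \<le> delta m n x y"
  unfolding delta_sum by (rule sum_nonneg) simp

lemma delta_split: "m \<le> k \<Longrightarrow> k \<le> n \<Longrightarrow> delta m n x y = delta m k x y + delta k n x y"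
  unfolding delta_sum by (simp add: sum.atLeastLessThan_concat)

lemma delta_mono: "m' \<le> m \<Longrightarrow> n \<le> n' \<Longrightarrow> delta m n x y \<le> delta m' n' x y"
  unfolding delta_sum by (rule sum_mono2) auto

lemma delta_cong:
  "(\<And>i. m \<le> i \<Longrightarrow> i < n \<Longrightarrow> x i = x' i \<and> y i = y' i) \<Longrightarrow> delta m n x y = delta m n x' y'"
  unfolding delta_sum by (rule sum.cong) auto

lemma delta_triangle: "delta m n x z \<le> delta m n x y + delta m n y z"
  unfolding delta_sum sum.distrib[symmetric] by (rule sum_mono) auto

lemma delta_all_differ:
  "(\<And>i. m \<le> i \<Longrightarrow> i < n \<Longrightarrow> x i \<noteq> y i) \<Longrightarrow> delta m n x y = (\<Sum>k\<in>{m..<n}. 1 / (real k + 1))"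
  unfolding delta_sum by (rule sum.cong) auto

lemma delta_le_harmonic: "delta m n x y \<le> (\<Sum>k\<in>{m..<n}. 1 / (real k + 1))"
  unfolding delta_sum by (rule sum_mono) auto

lemma harmonic_tail_unbounded: "\<exists>n>m. c < (\<Sum>k\<in>{m..<n}. 1 / (real k + 1))"
proof (rule ccontr)
  let ?f = "\<lambda>k. 1 / (real k + 1)"
  assume "\<not> ?thesis"
  then have c: "sum ?f {m..<n} \<le> c" if "m < n" for n
    using that by (meson not_less)
  have "sum ?f {..<n} \<le> sum ?f {..<Suc m} + \<bar>c\<bar>" for n
  proof -
    have "sum ?f {..<n} \<le> sum ?f {..<max n (Suc m)}" by (rule sum_mono2) auto
    also have "\<dots> = sum ?f {..<m} + sum ?f {m..<max n (Suc m)}"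
      using sum.atLeastLessThan_concat[of 0 m "max n (Suc m)" ?f] by (simp add: lessThan_atLeast0)
    also have "\<dots> \<le> sum ?f {..<Suc m} + \<bar>c\<bar>"
      using c[of "max n (Suc m)"] by (intro add_mono sum_mono2 order_trans[OF _ abs_ge_self]) simp_all
    finally show ?thesis .
  qed
  then have "summable ?f" by (intro summableI_nonneg_bounded) auto
  moreover have "?f = (\<lambda>k. inverse (real (Suc k)))" by (auto simp: inverse_eq_divide add.commute)
  ultimately show False
    using not_summable_harmonic[where ?'a = real] summable_Suc_iff[of "\<lambda>k. inverse (real k)"]
    by simp
qed

lemma E2_iff_summable:
  "E2 x y \<longleftrightarrow> summable (\<lambda>k. if x k \<noteq> y k then 1 / (real k + 1) else 0)"
proof -
  let ?f = "\<lambda>k. if x k \<noteq> y k then 1 / (real k + 1) else 0"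
  have eq: "delta_inf x y = (\<Sum>k. ennreal (?f k))"
    unfolding delta_inf_def by (intro suminf_cong) simp
  show ?thesis
  proof
    assume "E2 x y"
    then show "summable ?f"
      unfolding E2_def eq by (intro summable_suminf_not_top) auto
  next
    assume "summable ?f"
    then have "(\<Sum>k. ennreal (?f k)) = ennreal (suminf ?f)" by (intro suminf_ennreal2) auto
    then show "E2 x y" unfolding E2_def eq by simp
  qed
qed

lemma E2_iff_bounded: "E2 x y \<longleftrightarrow> (\<exists>c. \<forall>n. delta 0 n x y \<le> c)"
proof
  assume "E2 x y"
  then have "delta 0 n x y \<le> (\<Sum>k. if x k \<noteq> y k then 1 / (real k + 1) else 0)" for n
    unfolding E2_iff_summable delta_sum atLeast0LessThan by (intro sum_le_suminf) auto
  then show "\<exists>c. \<forall>n. delta 0 n x y \<le> c" by blast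
next
  assume "\<exists>c. \<forall>n. delta 0 n x y \<le> c"
  then obtain c where "\<And>n. delta 0 n x y \<le> c" by blast
  then show "E2 x y"
    unfolding E2_iff_summable delta_sum atLeast0LessThan by (intro summableI_nonneg_bounded[of _ c]) auto
qed

lemma E2_tail:
  assumes "E2 x y" "0 < e"
  shows "\<exists>n\<ge>p. \<forall>m. delta n m x y \<le> e"
proof -
  let ?f = "\<lambda>k. if x k \<noteq> y k then 1 / (real k + 1) else 0"
  obtain n where n: "\<forall>m\<ge>n. \<forall>k. norm (sum ?f {m..<k}) < e"
    using assms unfolding E2_iff_summable summable_Cauchy by blast
  have "delta (max n p) m x y \<le> e" for m
  proof -
    have "norm (delta (max n p) m x y) < e" using n unfolding delta_sum by simp
    then show ?thesis by simp
  qed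
  then show ?thesis by (intro exI[of _ "max n p"]) simp
qed

lemma E2_finite_diff:
  assumes "finite {i. x i \<noteq> y i}"
  shows "E2 x y"
proof -
  have "delta 0 n x y \<le> (\<Sum>k | x k \<noteq> y k. 1 / (real k + 1))" for n
    unfolding delta_def using assms by (intro sum_mono2) auto
  then show ?thesis unfolding E2_iff_bounded by blast
qed

lemma E2_commute: "E2 x y \<longleftrightarrow> E2 y x"
  unfolding E2_iff_bounded by (simp add: delta_commute[of _ _ x y])

text \<open>The blocks between consecutive \<open>l k\<close> are disjoint and contribute at least
  \<open>c\<close> each, so the weights of initial segments exceed every bound.\<close>

lemma not_E2I:
  assumes "0 < c" "\<And>k. l k \<le> l (Suc k)" "\<And>k. c \<le> delta (l k) (l (Suc k)) x y"
  shows "\<not> E2 x y"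
proof
  assume "E2 x y"
  then obtain b where b: "\<And>n. delta 0 n x y \<le> b" unfolding E2_iff_bounded by blast
  have "real k * c \<le> delta 0 (l k) x y" for k
  proof (induction k)
    case (Suc k)
    then show ?case
      using delta_split[of 0 "l k" "l (Suc k)" x y] assms(2,3)[of k] by (simp add: algebra_simps)
  qed (simp add: delta_nonneg)
  then have "real k * c \<le> b" for k using b order_trans by blast
  then show False using reals_Archimedean3[OF assms(1)] by (metis linorder_not_less)
qed

lemma E2I_geometric:
  assumes l: "\<And>k. l k \<le> l (Suc k)" "\<And>k. k \<le> l k"
    and d: "\<And>k. delta (l k) (l (Suc k)) x y \<le> (1 / 2) ^ k"
  shows "E2 x y"
proof -
  \<comment> \<open>The quantity \<open>2 - 2 * (1 / 2) ^ k\<close> is the sum of the first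
    \<open>k\<close> terms of the geometric series that bounds the blocks.\<close>
  have *: "delta 0 (l k) x y \<le> delta 0 (l 0) x y + 2 - 2 * (1 / 2) ^ k" for k
  proof (induction k)
    case (Suc k)
    then show ?case
      using delta_split[of 0 "l k" "l (Suc k)" x y] l(1)[of k] d[of k] by simp
  qed simp
  have "delta 0 n x y \<le> delta 0 (l 0) x y + 2" for n
  proof -
    have "delta 0 n x y \<le> delta 0 (l n) x y" using l(2)[of n] by (intro delta_mono) auto
    also have "\<dots> \<le> delta 0 (l 0) x y + 2 - 2 * (1 / 2) ^ n" by (rule *)
    also have "\<dots> \<le> delta 0 (l 0) x y + 2" by simp
    finally show ?thesis .
  qed
  then show ?thesis unfolding E2_iff_bounded by blast
qed

text \<open>Beyond \<open>r\<close> every harmonic term is below \<open>e / 2\<close>. The first sum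
  starting at \<open>r\<close> that reaches \<open>e / 2\<close> therefore overshoots by less than
  one such term and stays below \<open>e\<close>; \<open>y\<close> flips exactly the bits in this
  interval.\<close>

lemma small_flip:
  assumes "0 < e"
  obtains y q where "y \<in> cyl x p" "p \<le> q" "\<And>i. q \<le> i \<Longrightarrow> y i = x i"
    "\<And>m. delta 0 m x y < e" "e / 2 \<le> delta p q x y"
proof -
  obtain r0 where "inverse (real (Suc r0)) < e / 2"
    using reals_Archimedean[of "e / 2"] assms by auto
  define r where "r = max p r0"
  have r: "1 / (real i + 1) < e / 2" if "r \<le> i" for i
  proof -
    have "1 / (real i + 1) \<le> inverse (real (Suc r0))"
      using that by (simp add: r_def inverse_eq_divide frac_le)
    then show ?thesis using \<open>inverse (real (Suc r0)) < e / 2\<close> by linarith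
  qed
  let ?h = "\<lambda>q. \<Sum>k\<in>{r..<q}. 1 / (real k + 1)"
  define q where "q = (LEAST q. e / 2 \<le> ?h q)"
  have "\<exists>q. e / 2 \<le> ?h q" using harmonic_tail_unbounded[of r "e / 2"] less_imp_le by blast
  then have q: "e / 2 \<le> ?h q" unfolding q_def by (rule LeastI_ex)
  have "r < q"
  proof (rule ccontr)
    assume "\<not> r < q"
    then have "?h q = 0" by simp
    then show False using q assms by simp
  qed
  then obtain q0 where q0: "q = Suc q0" "r \<le> q0" by (cases q) auto
  have "\<not> e / 2 \<le> ?h q0" using not_less_Least[of q0 "\<lambda>q. e / 2 \<le> ?h q"] q0(1) by (simp add: q_def)
  then have h: "?h q < e" using r[OF q0(2)] q0 by simp
  define y where "y = (\<lambda>i. if r \<le> i \<and> i < q then \<not> x i else x i)"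
  have "delta 0 m x y < e" for m
  proof -
    have "delta 0 m x y \<le> ?h q"
      unfolding delta_def by (rule sum_mono2) (auto simp: y_def split: if_splits)
    then show ?thesis using h by linarith
  qed
  moreover have "e / 2 \<le> delta p q x y"
  proof -
    have "delta r q x y = ?h q" by (rule delta_all_differ) (simp add: y_def)
    moreover have "delta r q x y \<le> delta p q x y" by (rule delta_mono) (simp_all add: r_def)
    ultimately show ?thesis using q by linarith
  qed
  moreover have "y \<in> cyl x p" by (rule cylI) (simp add: y_def r_def)
  moreover have "p \<le> q" using \<open>r < q\<close> by (simp add: r_def)
  ultimately show ?thesis using that[of y q] by (simp add: y_def)
qed

subsection \<open>Homomorphisms of \<open>E\<^sub>2\<close>\<close>

text \<open>The exceptional meager set is given as an explicit sequence of closed nowhere dense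
  sets, so that a limit construction can avoid them one at a time.\<close>

locale E2_hom =
  fixes \<theta> :: "cantor \<Rightarrow> cantor" and N :: "nat \<Rightarrow> cantor set"
  assumes closed_N: "closed (N k)" and interior_N: "interior (N k) = {}"
    and continuous_off_N: "x \<notin> (\<Union>k. N k) \<Longrightarrow> \<exists>l. \<forall>z\<in>cyl x l - (\<Union>k. N k). \<theta> z \<in> cyl (\<theta> x) n"
    and hom: "E2 x y \<Longrightarrow> E2 (\<theta> x) (\<theta> y)"
begin

section \<open>Generic points and their finite modifications\<close>

definition G :: "cantor set" where
  "G = - (\<Union>k. N k)"

text \<open>This is the largest subset of \<open>G\<close> closed under finite modifications.
  Starting in \<open>H\<close>, bits can be flipped without leaving the region where
  \<open>\<theta>\<close> is controlled.\<close>

definition H :: "cantor set" where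
  "H = {x. \<forall>y. finite {i. x i \<noteq> y i} \<longrightarrow> y \<in> G}"

lemma H_subset_G: "x \<in> H \<Longrightarrow> x \<in> G"
  by (simp add: H_def)

lemma H_finite_diff:
  assumes "x \<in> H" "finite {i. x i \<noteq> y i}"
  shows "y \<in> H"
  unfolding H_def
proof (intro CollectI allI impI)
  fix z assume "finite {i. y i \<noteq> z i}"
  then have "finite {i. x i \<noteq> z i}"
    using assms(2) by (rule_tac finite_subset[of _ "{i. x i \<noteq> y i} \<union> {i. y i \<noteq> z i}"]) auto
  then show "z \<in> G" using assms(1) by (simp add: H_def)
qed

text \<open>Finite modifications are given by the countably many maps \<open>t s\<close>, which are
  continuous involutions. Preimages of the \<open>N k\<close> under them are again closed and
  nowhere dense, so by Baire category they do not cover the space.\<close>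

lemma H_nonempty: "\<exists>x. x \<in> H"
proof (rule ccontr)
  assume empty: "\<nexists>x. x \<in> H"
  define t :: "bool list \<Rightarrow> cantor \<Rightarrow> cantor"
    where "t = (\<lambda>s x i. x i \<noteq> (i < length s \<and> s ! i))"
  have t_t: "t s (t s x) = x" for s x by (auto simp: t_def)
  have "continuous_on UNIV (\<lambda>x. t s x i)" for s i
    unfolding t_def
    by (rule continuous_on_compose2[OF _ continuous_on_product_coordinates[of i], of UNIV "\<lambda>b. b \<noteq> (i < length s \<and> s ! i)"])
      (auto simp: continuous_on_discrete)
  then have cont: "continuous_on UNIV (t s)" for s
    by (rule continuous_on_coordinatewise_then_product)
  have "meager (\<Union>s. \<Union>k. t s -` N k)"
  proof (intro meager_UN meager_UN_nat meager_nowhere_dense)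
    fix s k
    show "closed (t s -` N k)" using closed_N cont by (rule closed_vimage)
    have "t s -` interior (t s -` N k) \<subseteq> interior (N k)"
    proof (rule interior_maximal)
      show "t s -` interior (t s -` N k) \<subseteq> N k"
        using interior_subset[of "t s -` N k"] t_t by force
      show "open (t s -` interior (t s -` N k))" using open_interior cont by (rule open_vimage)
    qed
    then show "interior (t s -` N k) = {}"
      using interior_N t_t by (metis (no_types, lifting) all_not_in_conv subset_empty vimageI)
  qed simp_all
  moreover have "x \<in> (\<Union>s. \<Union>k. t s -` N k)" for x
  proof -
    have "x \<notin> H" using empty by blast
    then obtain y where y: "finite {i. x i \<noteq> y i}" "y \<notin> G" by (auto simp: H_def)
    obtain n where n: "{i. x i \<noteq> y i} \<subseteq> {..<n}" using finite_nat_bounded[OF y(1)] ..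
    then have "t (map (\<lambda>i. x i \<noteq> y i) [0..<n]) x = y" by (fastforce simp: t_def)
    moreover obtain k where "y \<in> N k" using y(2) unfolding G_def by blast
    ultimately have "x \<in> t (map (\<lambda>i. x i \<noteq> y i) [0..<n]) -` N k" by (simp only: vimage_eq)
    then show ?thesis by blast
  qed
  then have "(\<Union>s. \<Union>k. t s -` N k) = UNIV" by blast
  ultimately show False using not_meager_open[of UNIV] by simp
qed

section \<open>Decided initial segments and limits of constructions\<close>

text \<open>A forcing notion: \<open>l\<close> bits of \<open>y\<close> settle both the avoidance of
  some exceptional sets and, for generic points, part of the image. The clause
  \<open>n \<le> l\<close> makes the decided lengths tend to infinity along with
  \<open>n\<close>.\<close>

definition decides :: "cantor \<Rightarrow> nat \<Rightarrow> nat \<Rightarrow> bool" where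
  "decides y n l \<longleftrightarrow>
     n \<le> l \<and> (\<forall>j<n. cyl y l \<inter> N j = {}) \<and> (\<forall>z\<in>cyl y l \<inter> G. \<theta> z \<in> cyl (\<theta> y) n)"

lemma decides_mono: "decides y n l \<Longrightarrow> l \<le> l' \<Longrightarrow> decides y n l'"
  unfolding decides_def using cyl_antimono[of l l' y] by fastforce

lemma decides_exists:
  assumes "y \<in> G"
  shows "\<exists>l\<ge>p. decides y n l"
proof -
  have "\<exists>l. \<forall>j<n. cyl y l \<inter> N j = {}"
  proof (induction n)
    case (Suc n)
    then obtain l where l: "\<forall>j<n. cyl y l \<inter> N j = {}" ..
    have "open (- N n)" "y \<in> - N n" using closed_N assms by (auto simp: G_def)
    then obtain l' where l': "cyl y l' \<subseteq> - N n" by (rule open_contains_cyl)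
    have "cyl y (max l l') \<inter> N j = {}" if "j < Suc n" for j
    proof (cases "j = n")
      case True
      then show ?thesis using l' cyl_antimono[of l' "max l l'" y] by auto
    next
      case False
      then have "cyl y l \<inter> N j = {}" using l that by simp
      then show ?thesis using cyl_antimono[of l "max l l'" y] by auto
    qed
    then show ?case by blast
  qed simp
  then obtain l where l: "\<forall>j<n. cyl y l \<inter> N j = {}" ..
  obtain l' where l': "\<forall>z\<in>cyl y l' - (\<Union>k. N k). \<theta> z \<in> cyl (\<theta> y) n"
    using continuous_off_N[of y n] assms by (auto simp: G_def)
  let ?l = "max (max l l') (max n p)"
  have "cyl y ?l \<subseteq> cyl y l" "cyl y ?l \<subseteq> cyl y l'" by (rule cyl_antimono, simp)+
  then have "decides y n ?l"
    unfolding decides_def using l l' by (auto simp: G_def)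
  then show ?thesis by (intro exI[of _ ?l]) simp
qed

text \<open>The cylinders are nested and their lengths unbounded, so they have a common point. It
  lies in \<open>G\<close> because stage \<open>Suc j\<close> already excludes \<open>N j\<close>,
  and being in \<open>G\<close> it has the image values decided at every stage.\<close>

lemma fusion:
  fixes y :: "nat \<Rightarrow> cantor"
  assumes dec: "\<And>k. decides (y k) (n k) (l k)" and step: "\<And>k. y (Suc k) \<in> cyl (y k) (l k)"
    and l: "\<And>k. l k \<le> l (Suc k)" and n: "\<And>k. n k < n (Suc k)"
  shows "\<exists>z\<in>G. \<forall>k. z \<in> cyl (y k) (l k) \<and> \<theta> z \<in> cyl (\<theta> (y k)) (n k)"
proof -
  have kn: "k \<le> n k" for k using strict_mono_imp_increasing[of n k] n by (simp add: strict_mono_Suc_iff)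
  have kl: "k \<le> l k" for k using kn[of k] dec[of k] by (simp add: decides_def)
  have later: "y k' \<in> cyl (y k) (l k)" if "k \<le> k'" for k k'
    using that
  proof (induction k' rule: dec_induct)
    case (step m)
    have "l k \<le> l m" using lift_Suc_mono_le[of l k m] l step.hyps by blast
    then have "y (Suc m) \<in> cyl (y m) (l k)" using assms(2)[of m] cyl_antimono by blast
    then show ?case using cyl_eq[OF step.IH] by simp
  qed simp
  \<comment> \<open>Bit \<open>i\<close> is frozen from stage \<open>Suc i\<close> on, since
    \<open>i < Suc i \<le> l (Suc i)\<close>.\<close>
  define z where "z = (\<lambda>i. y (Suc i) i)"
  have z: "z \<in> cyl (y k) (l k)" for k
  proof (rule cylI)
    fix i assume i: "i < l k"
    show "z i = y k i"
    proof (cases "k \<le> Suc i")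
      case True
      then show ?thesis unfolding z_def using cylD[OF later[OF True] i] by simp
    next
      case False
      then have "y k \<in> cyl (y (Suc i)) (l (Suc i))" by (intro later) simp
      then have "y k i = y (Suc i) i" using kl[of "Suc i"] by (intro cylD) auto
      then show ?thesis by (simp add: z_def)
    qed
  qed
  have "z \<notin> N j" for j
  proof -
    have "j < n (Suc j)" using kn[of "Suc j"] by simp
    then have "cyl (y (Suc j)) (l (Suc j)) \<inter> N j = {}" using dec[of "Suc j"] unfolding decides_def by blast
    then show ?thesis using z by blast
  qed
  then have "z \<in> G" by (simp add: G_def)
  moreover have "\<theta> z \<in> cyl (\<theta> (y k)) (n k)" for k
    using dec[of k] z[of k] \<open>z \<in> G\<close> unfolding decides_def by blast
  ultimately show ?thesis using z by blast
qed

text \<open>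
  Otherwise, flipping further and further out sets of weight at most \<open>2\<^sup>-\<^sup>k\<close> each of which moves
  the image by a fixed amount yields \<open>E\<^sub>2\<close>-equivalent points with inequivalent images.
\<close>

lemma locally_uniform:
  assumes "0 < e"
  obtains x p d where "x \<in> H" "0 < d"
    "\<And>y z m. y \<in> H \<Longrightarrow> z \<in> H \<Longrightarrow> y \<in> cyl x p \<Longrightarrow> z \<in> cyl x p \<Longrightarrow> finite {i. y i \<noteq> z i} \<Longrightarrow>
       \<forall>m. delta 0 m y z < d \<Longrightarrow> delta 0 m (\<theta> y) (\<theta> z) \<le> e"
proof (rule ccontr)
  note thesisI = that
  assume contra: "\<not> thesis"
  \<comment> \<open>If the statement fails, every cylinder around a point of \<open>H\<close>
    contains, for every \<open>d\<close>, a bad pair: its points are finite modifications of each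
    other of weight below \<open>d\<close>, but their images are more than \<open>e\<close>
    apart.\<close>
  have bad: "\<exists>y z m. y \<in> H \<and> z \<in> H \<and> y \<in> cyl x p \<and> z \<in> cyl x p \<and> finite {i. y i \<noteq> z i} \<and>
       (\<forall>m. delta 0 m y z < d) \<and> e < delta 0 m (\<theta> y) (\<theta> z)" if xd: "x \<in> H" "0 < d" for x p d
  proof (rule ccontr)
    assume "\<not> ?thesis"
    then have "thesis" by (intro thesisI[OF xd, of p]) (meson not_less)
    then show False using contra by contradiction
  qed
  define P where "P = (\<lambda>(k::nat) (x, y, n, l).
    x \<in> H \<and> y \<in> H \<and> decides x n l \<and> decides y n l \<and> (\<forall>i\<ge>l. x i = y i))"
  define Q where "Q = (\<lambda>k (x, y, n, l) (x', y', n', l').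
    x' \<in> cyl x l \<and> y' \<in> cyl y l \<and> l \<le> l' \<and> n < n' \<and>
    e / 2 < delta n n' (\<theta> x') (\<theta> y') \<and> (\<forall>m. delta l m x' y' \<le> (1 / 2) ^ k))"
  have "\<exists>f. \<forall>k. P k (f k) \<and> Q k (f k) (f (Suc k))"
  proof (rule dependent_nat_choice)
    obtain x where x: "x \<in> H" using H_nonempty ..
    obtain l where "decides x 0 l" using decides_exists[OF H_subset_G[OF x]] by blast
    then show "\<exists>s. P 0 s" using x by (intro exI[of _ "(x, x, 0, l)"]) (simp add: P_def)
  next
    fix s k assume Ps: "P k s"
    obtain x y n l where s: "s = (x, y, n, l)" by (cases s)
    from Ps have x: "x \<in> H" and y: "y \<in> H" and dx: "decides x n l" and dy: "decides y n l"
      and xy: "\<And>i. l \<le> i \<Longrightarrow> x i = y i" unfolding s P_def by auto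
    obtain u v m where u: "u \<in> H" "u \<in> cyl y l" and v: "v \<in> H" "v \<in> cyl y l"
      and fin: "finite {i. u i \<noteq> v i}" and uv: "\<And>m. delta 0 m u v < (1 / 2) ^ k"
      and big: "e < delta 0 m (\<theta> u) (\<theta> v)"
      using bad[OF y, of "(1 / 2) ^ k" l] by auto
    define x' where "x' = (\<lambda>i. if i < l then x i else u i)"
    have x'_u: "finite {i. u i \<noteq> x' i}"
      by (rule finite_subset[of _ "{..<l}"]) (auto simp: x'_def)
    have x'H: "x' \<in> H" using H_finite_diff[OF u(1) x'_u] .
    have near: "\<theta> w i = \<theta> y i" if "w \<in> H" "w \<in> cyl y l" "i < n" for w i
    proof -
      have "\<theta> w \<in> cyl (\<theta> y) n"
        using dy that(2) H_subset_G[OF that(1)] unfolding decides_def by blast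
      then show ?thesis using that(3) by (rule cylD)
    qed
    \<comment> \<open>Both images agree with \<open>\<theta> y\<close> below \<open>n\<close>, so
      their whole distance arises in the block from \<open>n\<close> on.\<close>
    have "delta 0 n (\<theta> u) (\<theta> v) = 0"
      using delta_cong[of 0 n "\<theta> u" "\<theta> y" "\<theta> v" "\<theta> y"] near[OF u] near[OF v] by simp
    then have "delta n m (\<theta> u) (\<theta> v) > e"
      using big delta_split[of 0 n m "\<theta> u" "\<theta> v"] delta_mono[of 0 0 m n "\<theta> u" "\<theta> v"] assms
      by (cases "n \<le> m") auto
    then have "e / 2 < delta n m (\<theta> x') (\<theta> u) \<or> e / 2 < delta n m (\<theta> x') (\<theta> v)"
      using delta_triangle[of n m "\<theta> u" "\<theta> v" "\<theta> x'"] delta_commute[of n m "\<theta> u" "\<theta> x'"]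
      by linarith
    then obtain y' where y': "y' = u \<or> y' = v" and far: "e / 2 < delta n m (\<theta> x') (\<theta> y')"
      by blast
    have y'H: "y' \<in> H" and y'cyl: "y' \<in> cyl y l" using y' u v by auto
    have "finite {i. x' i \<noteq> y' i}"
    proof (rule finite_subset)
      show "{i. x' i \<noteq> y' i} \<subseteq> {i. u i \<noteq> x' i} \<union> {i. u i \<noteq> v i}" using y' by auto
    qed (use x'_u fin in simp)
    then obtain r where r: "{i. x' i \<noteq> y' i} \<subseteq> {..<r}" using finite_nat_bounded by blast
    define n' where "n' = max m (Suc n)"
    obtain l1 where l1: "l1 \<ge> max l r" "decides x' n' l1"
      using decides_exists[OF H_subset_G[OF x'H]] by blast
    obtain l' where l': "l' \<ge> l1" "decides y' n' l'"
      using decides_exists[OF H_subset_G[OF y'H]] by blast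
    have "P (Suc k) (x', y', n', l')"
      unfolding P_def using x'H y'H decides_mono[OF l1(2) l'(1)] l' l1(1) r
      by (auto simp: subset_iff not_less[symmetric])
    moreover have "delta l m' x' y' \<le> (1 / 2) ^ k" for m'
    proof -
      have "delta l m' x' y' = delta l m' u y'" by (rule delta_cong) (simp add: x'_def)
      also have "\<dots> \<le> delta 0 m' u y'" by (rule delta_mono) simp_all
      also have "\<dots> \<le> (1 / 2) ^ k" using y' uv[of m'] by auto
      finally show ?thesis .
    qed
    moreover have "e / 2 < delta n n' (\<theta> x') (\<theta> y')"
      using far delta_mono[of n n m n' "\<theta> x'" "\<theta> y'"] by (simp add: n'_def)
    moreover have "x' \<in> cyl x l" by (rule cylI) (simp add: x'_def)
    moreover have "l \<le> l'" "n < n'" using l1 l' by (auto simp: n'_def)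
    ultimately have "P (Suc k) (x', y', n', l') \<and> Q k s (x', y', n', l')"
      unfolding s Q_def using y'cyl by auto
    then show "\<exists>t. P (Suc k) t \<and> Q k s t" ..
  qed
  then obtain f where f: "\<And>k. P k (f k)" "\<And>k. Q k (f k) (f (Suc k))" by blast
  define x y n l where "x = (\<lambda>k. fst (f k))" and "y = (\<lambda>k. fst (snd (f k)))"
    and "n = (\<lambda>k. fst (snd (snd (f k))))" and "l = (\<lambda>k. snd (snd (snd (f k))))"
  have f_eq: "f k = (x k, y k, n k, l k)" for k by (simp add: x_def y_def n_def l_def)
  have dec: "decides (x k) (n k) (l k)" "decides (y k) (n k) (l k)" for k
    using f(1)[of k] unfolding f_eq P_def by auto
  have step: "x (Suc k) \<in> cyl (x k) (l k)" "y (Suc k) \<in> cyl (y k) (l k)" "l k \<le> l (Suc k)"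
    "n k < n (Suc k)" "e / 2 < delta (n k) (n (Suc k)) (\<theta> (x (Suc k))) (\<theta> (y (Suc k)))"
    "delta (l k) m (x (Suc k)) (y (Suc k)) \<le> (1 / 2) ^ k" for k m
    using f(2)[of k] unfolding f_eq Q_def by auto
  obtain X where X: "X \<in> cyl (x k) (l k)" "\<theta> X \<in> cyl (\<theta> (x k)) (n k)" for k
    using fusion[of x n l, OF dec(1) step(1) step(3) step(4)] by blast
  obtain Y where Y: "Y \<in> cyl (y k) (l k)" "\<theta> Y \<in> cyl (\<theta> (y k)) (n k)" for k
    using fusion[of y n l, OF dec(2) step(2) step(3) step(4)] by blast
  have kl: "k \<le> l k" for k
    using strict_mono_imp_increasing[of n k] step(4) dec(1)[of k]
    by (simp add: strict_mono_Suc_iff decides_def)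
  have "E2 X Y"
  proof (rule E2I_geometric[OF step(3) kl])
    fix k
    have "delta (l k) (l (Suc k)) X Y = delta (l k) (l (Suc k)) (x (Suc k)) (y (Suc k))"
      using cylD[OF X(1)] cylD[OF Y(1)] by (intro delta_cong) simp
    then show "delta (l k) (l (Suc k)) X Y \<le> (1 / 2) ^ k" using step(6) by simp
  qed
  moreover have "\<not> E2 (\<theta> X) (\<theta> Y)"
  proof (rule not_E2I[of "e / 2" n])
    fix k
    have "delta (n k) (n (Suc k)) (\<theta> X) (\<theta> Y)
        = delta (n k) (n (Suc k)) (\<theta> (x (Suc k))) (\<theta> (y (Suc k)))"
      using cylD[OF X(2)] cylD[OF Y(2)] by (intro delta_cong) simp
    then show "e / 2 \<le> delta (n k) (n (Suc k)) (\<theta> X) (\<theta> Y)" using step(5)[of k] by simp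
    show "n k \<le> n (Suc k)" using step(4)[of k] by simp
  qed (use assms in simp)
  ultimately show False using hom by blast
qed

text \<open>The images are divided into blocks on each of which they differ by weight at most 1 and
  agree at least once. A run of disagreements then meets at most two consecutive blocks. Meanwhile
  \<open>x\<close> and \<open>Y\<close> collect weight at least \<open>d / 2\<close> at every stage,
  which makes them inequivalent.\<close>

lemma inequivalent_with_short_runs:
  obtains x y where "\<not> E2 x y"
    "\<And>i j. (\<And>k. i \<le> k \<Longrightarrow> k < j \<Longrightarrow> \<theta> x k \<noteq> \<theta> y k) \<Longrightarrow> delta i j (\<theta> x) (\<theta> y) \<le> 2"
proof -
  obtain x p d where x: "x \<in> H" and d: "0 < d"
    and unif: "\<And>y z m. y \<in> H \<Longrightarrow> z \<in> H \<Longrightarrow> y \<in> cyl x p \<Longrightarrow> z \<in> cyl x p \<Longrightarrow>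
      finite {i. y i \<noteq> z i} \<Longrightarrow> \<forall>m. delta 0 m y z < d \<Longrightarrow> delta 0 m (\<theta> y) (\<theta> z) \<le> 1 / 2"
    by (rule locally_uniform[of "1 / 2"]) auto
  \<comment> \<open>The tail bound \<open>1 / 2\<close> leaves room for another \<open>1 / 2\<close>
    from the next flip, giving blocks of weight at most 1. The last clause makes the blocks start at
    0, so that every index lies in one.\<close>
  define P where "P = (\<lambda>(k::nat) (y, n, l). y \<in> H \<and> p \<le> l \<and> y \<in> cyl x p \<and> decides y n l \<and>
    (\<forall>i\<ge>l. y i = x i) \<and> (\<forall>m. delta n m (\<theta> x) (\<theta> y) \<le> 1 / 2) \<and> (k = 0 \<longrightarrow> n = 0))"
  define Q where "Q = (\<lambda>(k::nat) (y, n, l) (y', n', l').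
    y' \<in> cyl y l \<and> l \<le> l' \<and> n < n' \<and> d / 2 \<le> delta l l' x y' \<and>
    delta n n' (\<theta> x) (\<theta> y') \<le> 1 \<and> (\<exists>i\<ge>n. i < n' \<and> \<theta> x i = \<theta> y' i))"
  have "\<exists>f. \<forall>k. P k (f k) \<and> Q k (f k) (f (Suc k))"
  proof (rule dependent_nat_choice)
    obtain l where "l \<ge> p" "decides x 0 l" using decides_exists[OF H_subset_G[OF x]] by blast
    then show "\<exists>s. P 0 s" using x by (intro exI[of _ "(x, 0, l)"]) (simp add: P_def)
  next
    fix s k assume Ps: "P k s"
    obtain y n l where s: "s = (y, n, l)" by (cases s)
    from Ps have y: "y \<in> H" "p \<le> l" "y \<in> cyl x p" and dec: "decides y n l"
      and yx: "\<And>i. l \<le> i \<Longrightarrow> y i = x i" and tail: "\<And>m. delta n m (\<theta> x) (\<theta> y) \<le> 1 / 2"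
      unfolding s P_def by auto
    obtain y' q where y': "y' \<in> cyl y l" "l \<le> q" "\<And>i. q \<le> i \<Longrightarrow> y' i = y i"
      and dy: "\<And>m. delta 0 m y y' < d" and dq: "d / 2 \<le> delta l q y y'"
      by (rule small_flip[OF d, where x = y and p = l]) blast
    have fin: "finite {i. y i \<noteq> y' i}"
      by (rule finite_subset[of _ "{..<q}"]) (use y'(3) in \<open>auto simp: not_less[symmetric]\<close>)
    then have y'H: "y' \<in> H" by (rule H_finite_diff[OF y(1)])
    have "y' \<in> cyl y p" using y'(1) cyl_antimono[OF y(2)] by blast
    then have y'cyl: "y' \<in> cyl x p" using cyl_eq[OF y(3)] by simp
    have y'x: "y' i = x i" if "q \<le> i" for i using y'(2,3) yx that by simp
    have tail': "delta n m (\<theta> x) (\<theta> y') \<le> 1" for m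
    proof -
      have "delta n m (\<theta> y) (\<theta> y') \<le> delta 0 m (\<theta> y) (\<theta> y')" by (rule delta_mono) simp_all
      also have "\<dots> \<le> 1 / 2" using unif[OF y(1) y'H y(3) y'cyl fin] dy by blast
      finally show ?thesis
        using delta_triangle[of n m "\<theta> x" "\<theta> y'" "\<theta> y"] tail[of m] by linarith
    qed
    have "finite {i. x i \<noteq> y' i}"
      by (rule finite_subset[of _ "{..<q}"]) (use y'x in \<open>auto simp: not_less[symmetric]\<close>)
    then have E: "E2 (\<theta> x) (\<theta> y')" by (intro hom E2_finite_diff)
    \<comment> \<open>Disagreement throughout an interval of harmonic weight above 1 would violate
      \<open>tail'\<close>, so an agreement occurs before \<open>r\<close>.\<close>
    obtain r where r: "n < r" "1 < (\<Sum>k\<in>{n..<r}. 1 / (real k + 1))"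
      using harmonic_tail_unbounded by blast
    have agree: "\<exists>i\<ge>n. i < r \<and> \<theta> x i = \<theta> y' i"
      using delta_all_differ[of n r "\<theta> x" "\<theta> y'"] tail'[of r] r(2) by force
    \<comment> \<open>The points \<open>x\<close> and \<open>y'\<close> differ only finitely, so
      their images are equivalent and the tail is again small from some place on; this restores the
      invariant \<open>P\<close>.\<close>
    obtain n' where n': "n' \<ge> r" "\<And>m. delta n' m (\<theta> x) (\<theta> y') \<le> 1 / 2"
      using E2_tail[OF E, of "1 / 2" r] by auto
    obtain l' where l': "l' \<ge> q" "decides y' n' l'"
      using decides_exists[OF H_subset_G[OF y'H]] by blast
    have "P (Suc k) (y', n', l')"
      unfolding P_def using y'H y(2) y'(2) y'cyl l' y'x n'(2) by simp
    moreover have "d / 2 \<le> delta l l' x y'"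
    proof -
      have "delta l q y y' = delta l q x y'" using yx by (intro delta_cong) simp
      then show ?thesis using dq delta_mono[of l l q l' x y'] l'(1) by simp
    qed
    moreover have "\<exists>i\<ge>n. i < n' \<and> \<theta> x i = \<theta> y' i" using agree n'(1) by (meson less_le_trans)
    ultimately have "P (Suc k) (y', n', l') \<and> Q k s (y', n', l')"
      unfolding s Q_def using y' l'(1) r(1) n'(1) tail' by auto
    then show "\<exists>t. P (Suc k) t \<and> Q k s t" ..
  qed
  then obtain f where f: "\<And>k. P k (f k)" "\<And>k. Q k (f k) (f (Suc k))" by blast
  define y n l where "y = (\<lambda>k. fst (f k))" and "n = (\<lambda>k. fst (snd (f k)))"
    and "l = (\<lambda>k. snd (snd (f k)))"
  have f_eq: "f k = (y k, n k, l k)" for k by (simp add: y_def n_def l_def)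
  have dec: "decides (y k) (n k) (l k)" and n0: "n 0 = 0" for k
    using f(1)[of k] f(1)[of 0] unfolding f_eq P_def by auto
  have step: "y (Suc k) \<in> cyl (y k) (l k)" "l k \<le> l (Suc k)" "n k < n (Suc k)"
    "d / 2 \<le> delta (l k) (l (Suc k)) x (y (Suc k))"
    "delta (n k) (n (Suc k)) (\<theta> x) (\<theta> (y (Suc k))) \<le> 1"
    "\<exists>i\<ge>n k. i < n (Suc k) \<and> \<theta> x i = \<theta> (y (Suc k)) i" for k
    using f(2)[of k] unfolding f_eq Q_def by auto
  obtain Y where Y: "Y \<in> cyl (y k) (l k)" "\<theta> Y \<in> cyl (\<theta> (y k)) (n k)" for k
    using fusion[of y n l, OF dec step(1) step(2) step(3)] by blast
  have "\<not> E2 x Y"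
  proof (rule not_E2I[of "d / 2" l])
    fix k
    have "delta (l k) (l (Suc k)) x Y = delta (l k) (l (Suc k)) x (y (Suc k))"
      using cylD[OF Y(1)] by (intro delta_cong) simp
    then show "d / 2 \<le> delta (l k) (l (Suc k)) x Y" using step(4)[of k] by simp
  qed (use d step(2) in auto)
  moreover have "delta i j (\<theta> x) (\<theta> Y) \<le> 2"
    if run: "\<And>k. i \<le> k \<Longrightarrow> k < j \<Longrightarrow> \<theta> x k \<noteq> \<theta> Y k" for i j
  proof -
    have block: "delta (n k) (n (Suc k)) (\<theta> x) (\<theta> Y) \<le> 1" for k
    proof -
      have "delta (n k) (n (Suc k)) (\<theta> x) (\<theta> Y) = delta (n k) (n (Suc k)) (\<theta> x) (\<theta> (y (Suc k)))"
        using cylD[OF Y(2)] by (intro delta_cong) simp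
      then show ?thesis using step(5)[of k] by simp
    qed
    have "strict_mono n" using step(3) by (simp add: strict_mono_Suc_iff)
    then have "\<exists>k. i < n k" using strict_mono_imp_increasing[of n "Suc i"] by (metis Suc_le_eq)
    \<comment> \<open>The run starts in the block that ends at \<open>n k\<close>; here
      \<open>k\<close> is positive because \<open>n 0 = 0\<close>. It must stop before the agreement
      found in the following block.\<close>
    define k where "k = (LEAST k. i < n k)"
    have ik: "i < n k" unfolding k_def by (rule LeastI_ex) fact
    with n0 obtain k0 where k0: "k = Suc k0" by (cases k) auto
    have ge: "n k0 \<le> i" using not_less_Least[of k0 "\<lambda>k. i < n k"] k0 k_def by simp
    obtain a where a: "n k \<le> a" "a < n (Suc k)" "\<theta> x a = \<theta> (y (Suc k)) a" using step(6) by blast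
    then have "\<theta> x a = \<theta> Y a" using cylD[OF Y(2)] by simp
    then have "j \<le> a" using run[of a] ik a(1) by (metis less_le_trans less_imp_le not_less)
    then have "delta i j (\<theta> x) (\<theta> Y) \<le> delta (n k0) (n (Suc k)) (\<theta> x) (\<theta> Y)"
      using ge a(2) by (intro delta_mono) auto
    also have "\<dots> = delta (n k0) (n k) (\<theta> x) (\<theta> Y) + delta (n k) (n (Suc k)) (\<theta> x) (\<theta> Y)"
      using step(3)[of k0] step(3)[of k] k0 by (intro delta_split) auto
    also have "\<dots> \<le> 2" using block[of k0] block[of k] k0 by simp
    finally show ?thesis .
  qed
  ultimately show ?thesis using that by blast
qed

end

lemma Sigma11_hom_short_runs:
  assumes "Sigma11 {(a, \<theta> a) | a. a \<in> UNIV}" "\<And>x y. E2 x y \<Longrightarrow> E2 (\<theta> x) (\<theta> y)"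
  shows "\<exists>x y. \<not> E2 x y \<and>
    (\<forall>i j. (\<forall>k. i \<le> k \<and> k < j \<longrightarrow> \<theta> x k \<noteq> \<theta> y k) \<longrightarrow> delta i j (\<theta> x) (\<theta> y) \<le> 2)"
proof -
  obtain M where M: "meager M"
    and cont: "\<And>x n. x \<notin> M \<Longrightarrow> \<exists>l. \<forall>z\<in>cyl x l - M. \<theta> z \<in> cyl (\<theta> x) n"
    using Sigma11_graph_continuous_off_meager[OF assms(1)] by blast
  obtain N :: "nat \<Rightarrow> cantor set"
    where N: "\<forall>k. closed (N k) \<and> interior (N k) = {}" "M \<subseteq> (\<Union>k. N k)"
    using M unfolding meager_def by blast
  \<comment> \<open>Continuity relative to the complement of \<open>M\<close> passes to the smaller
    complement of the union of the \<open>N k\<close>.\<close>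
  interpret E2_hom \<theta> N
  proof
    fix x n assume "x \<notin> (\<Union>k. N k)"
    then have "x \<notin> M" using N(2) by blast
    from cont[OF this] obtain l where "\<forall>z\<in>cyl x l - M. \<theta> z \<in> cyl (\<theta> x) n" ..
    then show "\<exists>l. \<forall>z\<in>cyl x l - (\<Union>k. N k). \<theta> z \<in> cyl (\<theta> x) n"
      using N(2) by (intro exI[of _ l]) blast
  qed (use N(1) assms(2) in auto)
  obtain x y where "\<not> E2 x y"
    "\<And>i j. (\<And>k. i \<le> k \<Longrightarrow> k < j \<Longrightarrow> \<theta> x k \<noteq> \<theta> y k) \<Longrightarrow> delta i j (\<theta> x) (\<theta> y) \<le> 2"
    by (rule inequivalent_with_short_runs) blast
  then show ?thesis by blast
qed

subsection \<open>The set \<open>D\<close>\<close>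

lemma tuple_pair [simp]: "tuple [x, y] 0 = x" "tuple [x, y] (Suc 0) = y"
  by (simp_all add: tuple_def)

lemma topspace_power_top [simp]: "topspace (power_top n) = {..<n} \<rightarrow>\<^sub>E UNIV"
  by (simp add: power_top_def)

lemma tuple_pair_in_PiE: "x \<in> A \<Longrightarrow> y \<in> A \<Longrightarrow> tuple [x, y] \<in> {..<2} \<rightarrow>\<^sub>E A"
  by (auto simp: tuple_def PiE_iff less_Suc_eq numeral_2_eq_2)

lemma tuple_pair_eta: "p \<in> {..<2} \<rightarrow>\<^sub>E A \<Longrightarrow> p = tuple [p 0, p 1]"
  by (auto simp: tuple_def PiE_iff extensional_def fun_eq_iff less_Suc_eq numeral_2_eq_2)

lemma D_set_iff:
  "p \<in> D_set \<longleftrightarrow> p \<in> topspace (power_top 2) \<and>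
     (\<exists>i j. i < j \<and> delta i j (p 0) (p 1) > 2 \<and> (\<forall>n. i \<le> n \<and> n < j \<longrightarrow> p 0 n \<noteq> p 1 n))"
  (is "_ \<longleftrightarrow> _ \<and> ?R p")
proof
  assume "p \<in> D_set"
  then obtain x y where p: "p = tuple [x, y]" and
    "\<exists>i j. i < j \<and> delta i j x y > 2 \<and> (\<forall>n. i \<le> n \<and> n < j \<longrightarrow> x n \<noteq> y n)"
    unfolding D_set_def by blast
  then show "p \<in> topspace (power_top 2) \<and> ?R p" by (simp add: tuple_pair_in_PiE)
next
  assume p: "p \<in> topspace (power_top 2) \<and> ?R p"
  then have "p = tuple [p 0, p 1]" by (intro tuple_pair_eta[of p UNIV]) simp
  then show "p \<in> D_set" using p unfolding D_set_def by blast
qed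

text \<open>On a run of disagreements \<open>delta\<close> equals the harmonic weight of the
  interval. So \<open>D_set\<close> is a union, over intervals of weight above 2, of finite
  intersections of open conditions on single bits.\<close>

lemma openin_D_set: "openin (power_top 2) D_set"
proof -
  let ?S = "topspace (power_top 2) :: (nat \<Rightarrow> cantor) set"
  let ?h = "\<lambda>i j. \<Sum>k\<in>{i..<j}. 1 / (real k + 1)"
  have coord: "openin (power_top 2) {p \<in> ?S. p a n = b}" if "a < 2" for a n b
  proof -
    have "continuous_map (power_top 2) (euclidean :: cantor topology) (\<lambda>p. p a)"
      unfolding power_top_def using that by (intro continuous_map_product_projection) simp
    moreover have "continuous_map (euclidean :: cantor topology) euclidean (\<lambda>x. x n)"
      by simp
    ultimately have "continuous_map (power_top 2) euclidean ((\<lambda>x. x n) \<circ> (\<lambda>p. p a :: cantor))"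
      by (rule continuous_map_compose)
    from openin_continuous_map_preimage[OF this, of "{b}"] show ?thesis
      by (simp add: open_discrete)
  qed
  have differ: "openin (power_top 2) {p \<in> ?S. p 0 n \<noteq> p 1 n}" for n
  proof -
    have "{p \<in> ?S. p 0 n \<noteq> p 1 n} =
        ({p \<in> ?S. p 0 n = True} \<inter> {p \<in> ?S. p 1 n = False}) \<union>
        ({p \<in> ?S. p 0 n = False} \<inter> {p \<in> ?S. p 1 n = True})"
      by auto
    then show ?thesis by (simp only:) (intro openin_Un openin_Int coord; simp)
  qed
  have "D_set = (\<Union>(i, j)\<in>{(i, j). i < j \<and> 2 < ?h i j}. \<Inter>n\<in>{i..<j}. {p \<in> ?S. p 0 n \<noteq> p 1 n})"
    (is "_ = ?U")
  proof (intro set_eqI iffI)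
    fix p assume "p \<in> D_set"
    then obtain i j where "p \<in> ?S" "i < j" "2 < delta i j (p 0) (p 1)"
      "\<forall>n. i \<le> n \<and> n < j \<longrightarrow> p 0 n \<noteq> p 1 n"
      unfolding D_set_iff by blast
    moreover from this have "2 < ?h i j" using delta_le_harmonic[of i j "p 0" "p 1"] by linarith
    ultimately show "p \<in> ?U" by (intro UN_I[of "(i, j)"]) auto
  next
    fix p assume "p \<in> ?U"
    then obtain i j where ij: "i < j" "2 < ?h i j" "p \<in> (\<Inter>n\<in>{i..<j}. {p \<in> ?S. p 0 n \<noteq> p 1 n})"
      by auto
    then have "p \<in> ?S" and ne: "\<And>n. i \<le> n \<Longrightarrow> n < j \<Longrightarrow> p 0 n \<noteq> p 1 n" by auto
    moreover have "delta i j (p 0) (p 1) > 2" using delta_all_differ[of i j "p 0" "p 1"] ne ij(2) by simp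
    ultimately show "p \<in> D_set" unfolding D_set_iff using ij(1) by blast
  qed
  \<comment> \<open>Here \<open>i < j\<close> provides the nonempty index set which
    \<open>openin_INT2\<close> asks for.\<close>
  moreover have "openin (power_top 2) (\<Inter>n\<in>{i..<j}. {p \<in> ?S. p 0 n \<noteq> p 1 n})" if "i < j" for i j
    by (rule openin_INT2) (use that differ in \<open>simp_all only: finite_atLeastLessThan atLeastLessThan_empty_iff not_not simp_thms\<close>)
  then have "openin (power_top 2) ?U"
    by (intro openin_Union) (clarsimp simp del: topspace_power_top)
  ultimately show ?thesis by simp
qed

text \<open>Inside a basic open set, the first point and a long enough initial segment of the second
  are kept. From then on the second takes the opposite bits of the first, and divergence of the
  harmonic series yields a run of weight above 2.\<close>

lemma D_set_dense: "power_top 2 closure_of D_set = topspace (power_top 2)"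
proof (intro equalityI closure_of_subset_topspace subsetI)
  fix p :: "nat \<Rightarrow> cantor" assume p: "p \<in> topspace (power_top 2)"
  have "\<exists>q\<in>D_set. q \<in> T" if T: "p \<in> T" "openin (power_top 2) T" for T
  proof -
    from product_topology_open_contains_basis[OF T(2)[unfolded power_top_def] T(1)]
    have "\<exists>U. p \<in> (\<Pi>\<^sub>E i\<in>{..<2}. U i) \<and> (\<forall>i. open (U i)) \<and> (\<Pi>\<^sub>E i\<in>{..<2}. U i) \<subseteq> T"
      by (elim ex_forward) simp
    then obtain U :: "nat \<Rightarrow> cantor set" where U: "p \<in> (\<Pi>\<^sub>E i\<in>{..<2}. U i)"
      "\<forall>i. open (U i)" "(\<Pi>\<^sub>E i\<in>{..<2}. U i) \<subseteq> T"
      by (elim exE conjE)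
    have p1: "p 1 \<in> U 1" "p 0 \<in> U 0"
      using PiE_mem[OF U(1), of 1] PiE_mem[OF U(1), of 0] by simp_all
    obtain n where n: "cyl (p 1) n \<subseteq> U 1" by (rule open_contains_cyl[OF U(2)[rule_format] p1(1)])
    define y where "y = (\<lambda>i. if i < n then p 1 i else \<not> p 0 i)"
    have "y \<in> U 1" using n by (auto simp: y_def intro: cylI)
    then have "tuple [p 0, y] \<in> (\<Pi>\<^sub>E i\<in>{..<2}. U i)"
      using p1(2) by (auto simp: tuple_def PiE_iff less_Suc_eq numeral_2_eq_2)
    moreover obtain j where j: "n < j" "2 < (\<Sum>k\<in>{n..<j}. 1 / (real k + 1))"
      using harmonic_tail_unbounded by blast
    have "delta n j (p 0) y > 2" "\<forall>k. n \<le> k \<and> k < j \<longrightarrow> p 0 k \<noteq> y k"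
      using j(2) delta_all_differ[of n j "p 0" y] by (simp_all add: y_def)
    then have "tuple [p 0, y] \<in> D_set"
      unfolding D_set_def using j(1) by blast
    ultimately show ?thesis using U(3) by blast
  qed
  then show "p \<in> power_top 2 closure_of D_set" unfolding in_closure_of using p by blast
qed

lemma comeager_D_set: "comeager_in (power_top 2) D_set"
proof -
  let ?X = "power_top 2 :: (nat \<Rightarrow> cantor) topology"
  have "closedin ?X (topspace ?X - D_set)" using openin_D_set by blast
  then have "nowhere_dense_in ?X (topspace ?X - D_set)"
    unfolding nowhere_dense_in_def
    by (simp only: closure_of_closedin interior_of_complement D_set_dense) auto
  then have "meager_in ?X (topspace ?X - D_set)"
    unfolding meager_in_def by (intro exI[of _ "\<lambda>_. topspace ?X - D_set"]) simp
  then show ?thesis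
    unfolding comeager_in_def using openin_subset[OF openin_D_set] by blast
qed

text \<open>The inequivalent pair with short image runs is mapped by the reduction to an
  inequivalent pair in \<open>B\<close>, and the bound 2 on its runs keeps it out of
  \<open>D_set\<close>.\<close>

lemma reduction_not_in_D_set:
  assumes "reducible UNIV E2 B E2"
  shows "\<not> bracket 2 B E2 \<subseteq> D_set"
proof
  assume sub: "bracket 2 B E2 \<subseteq> D_set"
  obtain \<theta> where \<theta>: "\<And>x. \<theta> x \<in> B" "Sigma11 {(a, \<theta> a) | a. a \<in> UNIV}"
    and red: "\<And>x y. E2 x y \<longleftrightarrow> E2 (\<theta> x) (\<theta> y)"
    using assms unfolding reducible_def witnesses_red_def Delta11_fun_def Delta11_def by auto
  obtain x y where xy: "\<not> E2 x y"
    "\<forall>i j. (\<forall>k. i \<le> k \<and> k < j \<longrightarrow> \<theta> x k \<noteq> \<theta> y k) \<longrightarrow> delta i j (\<theta> x) (\<theta> y) \<le> 2"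
    using Sigma11_hom_short_runs[OF \<theta>(2)] red by blast
  have ne: "\<not> E2 (\<theta> x) (\<theta> y)" "\<not> E2 (\<theta> y) (\<theta> x)" using xy(1) red E2_commute by blast+
  have "tuple [\<theta> x, \<theta> y] \<in> bracket 2 B E2"
    unfolding bracket_def
  proof (intro CollectI conjI allI impI)
    show "tuple [\<theta> x, \<theta> y] \<in> {..<2} \<rightarrow>\<^sub>E B" by (intro tuple_pair_in_PiE \<theta>(1))
    fix i j :: nat assume "i < 2" "j < 2" "i \<noteq> j"
    then consider "i = 0" "j = 1" | "i = 1" "j = 0" by linarith
    then show "\<not> E2 (tuple [\<theta> x, \<theta> y] i) (tuple [\<theta> x, \<theta> y] j)" by cases (simp_all add: ne)
  qed
  then have "tuple [\<theta> x, \<theta> y] \<in> D_set" using sub by blast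
  then obtain i j where "2 < delta i j (\<theta> x) (\<theta> y)" "\<forall>k. i \<le> k \<and> k < j \<longrightarrow> \<theta> x k \<noteq> \<theta> y k"
    unfolding D_set_iff by auto
  then show False using xy(2) by (meson not_less)
qed

lemma not_Mycielski_property_E2: "\<not> Mycielski_property 2 E2"
proof
  assume "Mycielski_property 2 E2"
  then obtain A where "bireducible UNIV E2 A E2" "bracket 2 A E2 \<subseteq> D_set"
    unfolding Mycielski_property_def using comeager_D_set by blast
  then show False using reduction_not_in_D_set unfolding bireducible_def by blast
qed

section \<open>Embeddings given by tree maps\<close>

text \<open>Block \<open>k\<close> is the interval from \<open>m (k - 1)\<close> to
  \<open>m k\<close>. For odd \<open>k\<close> the two arguments have the same bit at
  \<open>k - 1\<close>, so their images differ too little to disagree on the whole block. Every odd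
  block thus contains an agreement, a run meets at most three consecutive blocks, and three blocks
  weigh at most 15/8.\<close>

lemma tree_embedding_not_in_D_set:
  fixes m :: "nat \<Rightarrow> nat" and g :: "bool list \<Rightarrow> bool list"
  assumes mono: "strict_mono m" and m0: "m 0 = 0"
    and len: "\<forall>s. length (g s) = m (length s)"
    and same: "\<forall>k s t. k > 0 \<and> length s = k \<and> length t = k \<and> s ! (k - 1) = t ! (k - 1) \<longrightarrow>
      delta (m (k - 1)) (m k) ((!) (g s)) ((!) (g t)) < 1 / 2 ^ (k + 1)"
    and diff: "\<forall>k s t. k > 0 \<and> length s = k \<and> length t = k \<and> s ! (k - 1) \<noteq> t ! (k - 1) \<longrightarrow>
      \<bar>delta (m (k - 1)) (m k) ((!) (g s)) ((!) (g t)) - 1 / real k\<bar> < 1 / 2 ^ (k + 1)"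
    and \<Phi>: "\<forall>x. {(i, \<Phi> x i) | i. True} = (\<Union>n. {(i, g (restr x n) ! i) | i. i < length (g (restr x n))})"
  shows "tuple [\<Phi> (tilde [False]), \<Phi> (tilde [False, True])] \<notin> D_set"
proof
  let ?x = "tilde [False]" and ?y = "tilde [False, True]"
  let ?X = "\<Phi> ?x" and ?Y = "\<Phi> ?y"
  assume "tuple [?X, ?Y] \<in> D_set"
  then obtain i j where ij: "i < j" "2 < delta i j ?X ?Y"
    and run: "\<And>n. i \<le> n \<Longrightarrow> n < j \<Longrightarrow> ?X n \<noteq> ?Y n"
    unfolding D_set_iff by auto
  have \<Phi>_g: "\<Phi> x i = g (restr x k) ! i" if "i < m k" for x i k
  proof -
    have "(i, g (restr x k) ! i) \<in> {(i, \<Phi> x i) | i. True}"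
      unfolding \<Phi>[rule_format] using that len by (auto simp: restr_def)
    then show ?thesis by simp
  qed
  have bl: "delta (m (k - 1)) (m k) ?X ?Y
      = delta (m (k - 1)) (m k) ((!) (g (restr ?x k))) ((!) (g (restr ?y k)))" for k
    using \<Phi>_g by (intro delta_cong) simp
  have restr_nth: "restr x k ! i = x i" if "i < k" for x k i
    using that by (simp add: restr_def)
  have x_val: "restr ?x k ! (k - 1) = False" if "0 < k" for k
    using that by (simp add: restr_nth tilde_def)
  have "tilde [False, True] i = odd i" for i
    by (auto simp: tilde_def numeral_2_eq_2[symmetric] mod2_eq_if)
  then have y_val: "restr ?y k ! (k - 1) = even k" if "0 < k" for k
    using that by (simp add: restr_nth)
  have odd_block: "delta (m (k - 1)) (m k) ?X ?Y < 1 / 2 ^ (k + 1)" if "odd k" for k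
  proof -
    have "0 < k" using that by (cases k) auto
    then show ?thesis
      unfolding bl using x_val[of k] y_val[of k] that by (intro same[rule_format]) (auto simp: restr_def)
  qed
  have even_block: "delta (m (k - 1)) (m k) ?X ?Y < 1 / real k + 1 / 2 ^ (k + 1)" if "even k" "0 < k" for k
  proof -
    have "\<bar>delta (m (k - 1)) (m k) ?X ?Y - 1 / real k\<bar> < 1 / 2 ^ (k + 1)"
      unfolding bl using x_val[of k] y_val[of k] that by (intro diff[rule_format]) (auto simp: restr_def)
    then show ?thesis by linarith
  qed
  \<comment> \<open>The value 5/8 is \<open>1 / 2 + 1 / 8\<close>, the bound for the even block
    \<open>k = 2\<close>; later even blocks have smaller bounds, and odd blocks stay below
    1/2.\<close>
  have block: "delta (m (k - 1)) (m k) ?X ?Y \<le> 5 / 8" if "0 < k" for k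
  proof (cases "even k")
    case True
    with that have "2 \<le> k" by presburger
    have "1 / real k \<le> 1 / 2" using \<open>2 \<le> k\<close> by (simp add: frac_le)
    moreover have "(8::real) \<le> 2 ^ (k + 1)"
      using power_increasing[of 3 "k + 1" "2::real"] \<open>2 \<le> k\<close> by simp
    then have "1 / 2 ^ (k + 1) \<le> (1 / 8 :: real)" by (intro divide_left_mono) auto
    ultimately show ?thesis using even_block[OF True that] by linarith
  next
    case False
    have "(2::real) \<le> 2 ^ (k + 1)" using power_increasing[of 1 "k + 1" "2::real"] by simp
    then have "1 / 2 ^ (k + 1) \<le> (1 / 2 :: real)" by (intro divide_left_mono) auto
    then show ?thesis using odd_block[OF False] by linarith
  qed
  have agree: "\<exists>p\<ge>m (k - 1). p < m k \<and> ?X p = ?Y p" if "odd k" for k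
  proof (rule ccontr)
    assume "\<not> ?thesis"
    then have all: "delta (m (k - 1)) (m k) ?X ?Y = (\<Sum>i\<in>{m (k - 1)..<m k}. 1 / (real i + 1))"
      by (intro delta_all_differ) blast
    have k: "0 < k" using that by (cases k) auto
    \<comment> \<open>A pair with different last bits serves to bound the harmonic weight of block
      \<open>k\<close> from below by \<open>1 / k - 1 / 2 ^ (k + 1)\<close>, which exceeds
      \<open>1 / 2 ^ (k + 1)\<close>.\<close>
    define s t where "s = replicate k False" and "t = replicate k True"
    have "\<bar>delta (m (k - 1)) (m k) ((!) (g s)) ((!) (g t)) - 1 / real k\<bar> < 1 / 2 ^ (k + 1)"
      using k by (intro diff[rule_format]) (auto simp: s_def t_def)
    then have "1 / real k - 1 / 2 ^ (k + 1) < delta (m (k - 1)) (m k) ?X ?Y"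
      unfolding all using delta_le_harmonic[of "m (k - 1)" "m k" "(!) (g s)" "(!) (g t)"] by linarith
    moreover have "real k < 2 ^ k" by (rule of_nat_less_two_power)
    then have "1 / 2 ^ k < 1 / real k" using k by (simp add: frac_less2)
    moreover have "1 / 2 ^ k = 2 * (1 / 2 ^ (k + 1) :: real)" by simp
    ultimately show False using odd_block[OF that] by linarith
  qed
  have "\<exists>k. i < m k" using strict_mono_imp_increasing[OF mono, of "Suc i"] by (metis Suc_le_eq)
  define k where "k = (LEAST k. i < m k)"
  have ik: "i < m k" unfolding k_def by (rule LeastI_ex) fact
  with m0 obtain k0 where k0: "k = Suc k0" by (cases k) auto
  have ge: "m k0 \<le> i" using not_less_Least[of k0 "\<lambda>k. i < m k"] k0 k_def by simp
  \<comment> \<open>Block \<open>r\<close> is the first odd block after block \<open>k\<close>,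
    which contains \<open>i\<close>; the agreement in it lies beyond \<open>i\<close> and stops the
    run.\<close>
  obtain r where r: "odd r" "k < r" "r \<le> Suc (Suc k)"
  proof (cases "even k")
    case True
    then show ?thesis using that[of "Suc k"] by simp
  next
    case False
    then show ?thesis using that[of "Suc (Suc k)"] by simp
  qed
  obtain p where p: "m (r - 1) \<le> p" "p < m r" "?X p = ?Y p" using agree[OF r(1)] by blast
  have "m k \<le> m (r - 1)" "m r \<le> m (Suc (Suc k))"
    using r strict_mono_less_eq[OF mono] by simp_all
  then have "j \<le> p" using run[of p] ik p by (meson less_le_trans less_imp_le not_less order_trans)
  then have "delta i j ?X ?Y \<le> delta (m k0) (m (Suc (Suc k))) ?X ?Y"
    using ge p(2) \<open>m r \<le> m (Suc (Suc k))\<close> by (intro delta_mono) auto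
  also have "\<dots> = delta (m k0) (m k) ?X ?Y + (delta (m k) (m (Suc k)) ?X ?Y
      + delta (m (Suc k)) (m (Suc (Suc k))) ?X ?Y)"
    using strict_mono_less_eq[OF mono] k0 by (simp add: delta_split[symmetric])
  also have "\<dots> \<le> 5 / 8 + (5 / 8 + 5 / 8)"
    using block[of k] block[of "Suc k"] block[of "Suc (Suc k)"] k0 by (intro add_mono) simp_all
  finally show False using ij(2) by simp
qed

theorem theorem15p1:
  shows "openin (power_top 2) D_set \<and> power_top 2 closure_of D_set = topspace (power_top 2) \<and>
    (\<forall>(m :: nat \<Rightarrow> nat) (g :: bool list \<Rightarrow> bool list) (\<Phi> :: cantor \<Rightarrow> cantor).
       strict_mono m \<and> m 0 = 0 \<and>
       (\<forall>s. length (g s) = m (length s)) \<and>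
       (\<forall>s t. prefix s t \<longrightarrow> prefix (g s) (g t)) \<and>
       (\<forall>k s t. k > 0 \<and> length s = k \<and> length t = k \<and> s ! (k - 1) = t ! (k - 1) \<longrightarrow>
          delta (m (k - 1)) (m k) ((!) (g s)) ((!) (g t)) < 1 / 2 ^ (k + 1)) \<and>
       (\<forall>k s t. k > 0 \<and> length s = k \<and> length t = k \<and> s ! (k - 1) \<noteq> t ! (k - 1) \<longrightarrow>
          \<bar>delta (m (k - 1)) (m k) ((!) (g s)) ((!) (g t)) - 1 / real k\<bar> < 1 / 2 ^ (k + 1)) \<and>
       (\<forall>x. {(i, \<Phi> x i) | i. True} =
            (\<Union>n. {(i, g (restr x n) ! i) | i. i < length (g (restr x n))})) \<and>
       witnesses_red \<Phi> UNIV E2 (range \<Phi>) E2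
       \<longrightarrow> tuple [\<Phi> (tilde [False]), \<Phi> (tilde [False, True])] \<notin> D_set) \<and>
    (\<forall>B :: cantor set. Delta11 B \<and> bireducible B E2 UNIV E2 \<longrightarrow>
       \<not> bracket 2 B E2 \<subseteq> D_set) \<and>
    \<not> Mycielski_property 2 E2"
proof (intro conjI allI impI)
  show "openin (power_top 2) D_set" by (rule openin_D_set)
  show "power_top 2 closure_of D_set = topspace (power_top 2)" by (rule D_set_dense)
  show "\<not> Mycielski_property 2 E2" by (rule not_Mycielski_property_E2)
next
  fix B :: "cantor set"
  assume "Delta11 B \<and> bireducible B E2 UNIV E2"
  then show "\<not> bracket 2 B E2 \<subseteq> D_set"
    unfolding bireducible_def by (intro reduction_not_in_D_set) blast
next
  fix m :: "nat \<Rightarrow> nat" and g :: "bool list \<Rightarrow> bool list" and \<Phi> :: "cantor \<Rightarrow> cantor"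
  assume "strict_mono m \<and> m 0 = 0 \<and>
       (\<forall>s. length (g s) = m (length s)) \<and>
       (\<forall>s t. prefix s t \<longrightarrow> prefix (g s) (g t)) \<and>
       (\<forall>k s t. k > 0 \<and> length s = k \<and> length t = k \<and> s ! (k - 1) = t ! (k - 1) \<longrightarrow>
          delta (m (k - 1)) (m k) ((!) (g s)) ((!) (g t)) < 1 / 2 ^ (k + 1)) \<and>
       (\<forall>k s t. k > 0 \<and> length s = k \<and> length t = k \<and> s ! (k - 1) \<noteq> t ! (k - 1) \<longrightarrow>
          \<bar>delta (m (k - 1)) (m k) ((!) (g s)) ((!) (g t)) - 1 / real k\<bar> < 1 / 2 ^ (k + 1)) \<and>
       (\<forall>x. {(i, \<Phi> x i) | i. True} =
            (\<Union>n. {(i, g (restr x n) ! i) | i. i < length (g (restr x n))})) \<and>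
       witnesses_red \<Phi> UNIV E2 (range \<Phi>) E2"
  then show "tuple [\<Phi> (tilde [False]), \<Phi> (tilde [False, True])] \<notin> D_set"
    by (elim conjE) (rule tree_embedding_not_in_D_set)
qed

end
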